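(* Let $(M,d,\mu)$ be a metric measure space and $(\mathcal{E},\mathcal{F})$ a Dirichlet form on $L^2(M,\mu)$ with extended Dirichlet space $\mathcal{F}_e$. For every $1<q<\infty$, the space $V^q:=L^q(M,\mu)\cap\mathcal{F}_e$ with the norm $\|u\|_{V^q}:=\left(\|u\|_{L^q}^2+\mathcal{E}(u)\right)^{1/2}$ is a Banach space.
   Context: A metric measure space $(M,d,\mu)$ is a locally compact, separable metric space $(M,d)$ with a Radon measure $\mu$ of full support. $L^q:=L^q(M,\mu)$ (real-valued). A Dirichlet form $(\mathcal{E},\mathcal{F})$ on $L^2(M,\mu)$ is a symmetric non-negative bilinear form $\mathcal{E}$ with domain $\mathcal{F}$ dense in $L^2(M,\mu)$, such that $\mathcal{F}$ is a Hilbert space with inner product $(u,v)_{L^2}+\mathcal{E}(u,v)$, and such that for every $u\in\mathcal{F}$ the function $\bar u:=(u\vee0)\wedge1$ belongs to $\mathcal{F}$ with $\mathcal{E}(\bar u,\bar u)\le\mathcal{E}(u,u)$. Write $\mathcal{E}(u):=\mathcal{E}(u,u)$. Extended Dirichlet space: $\mathcal{F}_e$ is the set of all measurable functions $u$ on $M$ (identified when equal $\mu$-a.e.) for which there is an $\mathcal{E}$-Cauchy sequence $\{u_k\}\subset\mathcal{F}$ (i.e. $\mathcal{E}(u_k-u_l)\to0$ as $k,l\to\infty$) with $u_k\to u$ $\mu$-a.e.; then $\mathcal{E}(u,u):=\lim_k\mathcal{E}(u_k,u_k)$, which does not depend on the sequence chosen, and $\mathcal{E}$ is extended to a bilinear form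 on $\mathcal{F}_e$ by polarization. *)

theory Defs
  imports "HOL-Analysis.Analysis"
begin

section \<open>Banach spaces on a carrier set\<close>

locale banach_on =
  fixes V :: "'v set"
    and add :: "'v \<Rightarrow> 'v \<Rightarrow> 'v"
    and zero :: 'v
    and scale :: "real \<Rightarrow> 'v \<Rightarrow> 'v"
    and nrm :: "'v \<Rightarrow> real"
  assumes zero_closed: "zero \<in> V"
    and add_closed: "x \<in> V \<Longrightarrow> y \<in> V \<Longrightarrow> add x y \<in> V"
    and scale_closed: "x \<in> V \<Longrightarrow> scale c x \<in> V"
    and add_assoc: "x \<in> V \<Longrightarrow> y \<in> V \<Longrightarrow> z \<in> V \<Longrightarrow> add (add x y) z = add x (add y z)"
    and add_commute: "x \<in> V \<Longrightarrow> y \<in> V \<Longrightarrow> add x y = add y x"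
    and add_zero: "x \<in> V \<Longrightarrow> add zero x = x"
    and add_neg: "x \<in> V \<Longrightarrow> add x (scale (- 1) x) = zero"
    and scale_add_right: "x \<in> V \<Longrightarrow> y \<in> V \<Longrightarrow> scale c (add x y) = add (scale c x) (scale c y)"
    and scale_add_left: "x \<in> V \<Longrightarrow> scale (c + d) x = add (scale c x) (scale d x)"
    and scale_scale: "x \<in> V \<Longrightarrow> scale c (scale d x) = scale (c * d) x"
    and scale_one: "x \<in> V \<Longrightarrow> scale 1 x = x"
    and nrm_nonneg: "x \<in> V \<Longrightarrow> 0 \<le> nrm x"
    and nrm_eq_zero: "x \<in> V \<Longrightarrow> nrm x = 0 \<longleftrightarrow> x = zero"
    and nrm_scale: "x \<in> V \<Longrightarrow> nrm (scale c x) = \<bar>c\<bar> * nrm x"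
    and nrm_triangle: "x \<in> V \<Longrightarrow> y \<in> V \<Longrightarrow> nrm (add x y) \<le> nrm x + nrm y"
    and complete:
      "(\<And>n. s n \<in> V) \<Longrightarrow>
       (\<And>e. e > 0 \<Longrightarrow>
          \<exists>N. \<forall>m\<ge>N. \<forall>n\<ge>N. nrm (add (s m) (scale (- 1) (s n))) < e) \<Longrightarrow>
       \<exists>x\<in>V. (\<lambda>n. nrm (add (s n) (scale (- 1) x))) \<longlonglongrightarrow> 0"


section \<open>Function spaces modulo equality almost everywhere\<close>

text \<open>
  A space of \<open>M\<close>-a.e. classes is given by the set \<open>V\<close> of all measurable representatives of
  its elements; the space itself is the quotient of \<open>V\<close> by a.e. equality.
\<close>

definition ae_eq :: "'a measure \<Rightarrow> (('a \<Rightarrow> real) \<times> ('a \<Rightarrow> real)) set" where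
  "ae_eq M = {(u, v). u \<in> borel_measurable M \<and> v \<in> borel_measurable M \<and> (AE x in M. u x = v x)}"

definition ae_zero :: "'a measure \<Rightarrow> ('a \<Rightarrow> real) set" where
  "ae_zero M = ae_eq M `` {\<lambda>x. 0}"

definition ae_add ::
    "'a measure \<Rightarrow> ('a \<Rightarrow> real) set \<Rightarrow> ('a \<Rightarrow> real) set \<Rightarrow> ('a \<Rightarrow> real) set" where
  "ae_add M U W = (\<Union>u\<in>U. \<Union>w\<in>W. ae_eq M `` {\<lambda>x. u x + w x})"

definition ae_scale :: "'a measure \<Rightarrow> real \<Rightarrow> ('a \<Rightarrow> real) set \<Rightarrow> ('a \<Rightarrow> real) set" where
  "ae_scale M c U = (\<Union>u\<in>U. ae_eq M `` {\<lambda>x. c * u x})"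

text \<open>
  A function \<open>N\<close> of representatives is passed to classes by \<open>the_elem\<close>, which gives the common
  value of \<open>N\<close> on the class and is unspecified if \<open>N\<close> is not constant on it.
\<close>

definition ae_norm :: "(('a \<Rightarrow> real) \<Rightarrow> real) \<Rightarrow> ('a \<Rightarrow> real) set \<Rightarrow> real" where
  "ae_norm N U = the_elem (N ` U)"

definition ae_banach :: "'a measure \<Rightarrow> ('a \<Rightarrow> real) set \<Rightarrow> (('a \<Rightarrow> real) \<Rightarrow> real) \<Rightarrow> bool" where
  "ae_banach M V N \<longleftrightarrow>
     banach_on (V // ae_eq M) (ae_add M) (ae_zero M) (ae_scale M) (ae_norm N)"

definition Lq_space :: "'a measure \<Rightarrow> real \<Rightarrow> ('a \<Rightarrow> real) set" where
  "Lq_space M q = {u \<in> borel_measurable M. integrable M (\<lambda>x. \<bar>u x\<bar> powr q)}"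

definition Lq_norm :: "'a measure \<Rightarrow> real \<Rightarrow> ('a \<Rightarrow> real) \<Rightarrow> real" where
  "Lq_norm M q u = (\<integral>x. \<bar>u x\<bar> powr q \<partial>M) powr (1 / q)"


section \<open>Metric measure spaces\<close>

definition radon_measure :: "'a::topological_space measure \<Rightarrow> bool" where
  "radon_measure M \<longleftrightarrow>
     sets M = sets borel \<and>
     (\<forall>K. compact K \<longrightarrow> emeasure M K < \<infinity>) \<and>
     (\<forall>A\<in>sets M. emeasure M A = (INF U\<in>{U. open U \<and> A \<subseteq> U}. emeasure M U)) \<and>
     (\<forall>U. open U \<longrightarrow> emeasure M U = (SUP K\<in>{K. compact K \<and> K \<subseteq> U}. emeasure M K))"

definition metric_measure_space :: "'a::metric_space measure \<Rightarrow> bool" where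
  "metric_measure_space M \<longleftrightarrow>
     locally_compact_space (euclidean :: 'a topology) \<and>
     separable_space (euclidean :: 'a topology) \<and>
     radon_measure M \<and>
     (\<forall>U. open U \<and> U \<noteq> {} \<longrightarrow> emeasure M U > 0)"


section \<open>Dirichlet forms\<close>

text \<open>
  \<open>F\<close> is the set of representatives of the elements of the domain, and \<open>E\<close> is only constrained
  on \<open>F\<close>. The two \<open>ae\<close> axioms say that \<open>F\<close> and \<open>E\<close> come from a set of classes and a form on it.
  Since \<open>(u, v) \<mapsto> \<integral>u v \<partial>M + E u v\<close> is bilinear, symmetric and non-negative by the other
  axioms, it makes the space of classes a Hilbert space iff the norm it induces makes it a
  Banach space.
\<close>

locale dirichlet_form =
  fixes M :: "'a measure"
    and F :: "('a \<Rightarrow> real) set"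
    and E :: "('a \<Rightarrow> real) \<Rightarrow> ('a \<Rightarrow> real) \<Rightarrow> real"
  assumes dom_L2: "F \<subseteq> Lq_space M 2"
    and dom_ae: "u \<in> F \<Longrightarrow> v \<in> borel_measurable M \<Longrightarrow> (AE x in M. u x = v x) \<Longrightarrow> v \<in> F"
    and form_ae: "u \<in> F \<Longrightarrow> u' \<in> F \<Longrightarrow> (AE x in M. u x = u' x) \<Longrightarrow> v \<in> F \<Longrightarrow> E u v = E u' v"
    and dom_zero: "(\<lambda>x. 0) \<in> F"
    and dom_add: "u \<in> F \<Longrightarrow> v \<in> F \<Longrightarrow> (\<lambda>x. u x + v x) \<in> F"
    and dom_scale: "u \<in> F \<Longrightarrow> (\<lambda>x. c * u x) \<in> F"
    and dom_dense: "f \<in> Lq_space M 2 \<Longrightarrow> e > 0 \<Longrightarrow> \<exists>u\<in>F. Lq_norm M 2 (\<lambda>x. f x - u x) < e"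
    and form_sym: "u \<in> F \<Longrightarrow> v \<in> F \<Longrightarrow> E u v = E v u"
    and form_add: "u \<in> F \<Longrightarrow> v \<in> F \<Longrightarrow> w \<in> F \<Longrightarrow> E (\<lambda>x. u x + v x) w = E u w + E v w"
    and form_scale: "u \<in> F \<Longrightarrow> v \<in> F \<Longrightarrow> E (\<lambda>x. c * u x) v = c * E u v"
    and form_nonneg: "u \<in> F \<Longrightarrow> 0 \<le> E u u"
    and hilbert: "ae_banach M F (\<lambda>u. sqrt ((\<integral>x. u x * u x \<partial>M) + E u u))"
    and markov_dom: "u \<in> F \<Longrightarrow> (\<lambda>x. min (max (u x) 0) 1) \<in> F"
    and markov_form: "u \<in> F \<Longrightarrow>
      E (\<lambda>x. min (max (u x) 0) 1) (\<lambda>x. min (max (u x) 0) 1) \<le> E u u"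


section \<open>The extended Dirichlet space\<close>

definition approximates ::
    "'a measure \<Rightarrow> ('a \<Rightarrow> real) set \<Rightarrow> (('a \<Rightarrow> real) \<Rightarrow> ('a \<Rightarrow> real) \<Rightarrow> real) \<Rightarrow>
     (nat \<Rightarrow> 'a \<Rightarrow> real) \<Rightarrow> ('a \<Rightarrow> real) \<Rightarrow> bool" where
  "approximates M F E s u \<longleftrightarrow>
     (\<forall>k. s k \<in> F) \<and>
     (\<forall>e>0. \<exists>N. \<forall>k\<ge>N. \<forall>l\<ge>N. E (\<lambda>x. s k x - s l x) (\<lambda>x. s k x - s l x) < e) \<and>
     (AE x in M. (\<lambda>k. s k x) \<longlonglongrightarrow> u x)"

definition extended_domain ::
    "'a measure \<Rightarrow> ('a \<Rightarrow> real) set \<Rightarrow> (('a \<Rightarrow> real) \<Rightarrow> ('a \<Rightarrow> real) \<Rightarrow> real) \<Rightarrow>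
     ('a \<Rightarrow> real) set" where
  "extended_domain M F E = {u \<in> borel_measurable M. \<exists>s. approximates M F E s u}"

definition extended_energy ::
    "'a measure \<Rightarrow> ('a \<Rightarrow> real) set \<Rightarrow> (('a \<Rightarrow> real) \<Rightarrow> ('a \<Rightarrow> real) \<Rightarrow> real) \<Rightarrow>
     ('a \<Rightarrow> real) \<Rightarrow> real" where
  "extended_energy M F E u =
     (THE l. \<exists>s. approximates M F E s u \<and> (\<lambda>k. E (s k) (s k)) \<longlonglongrightarrow> l)"

definition Vq_space ::
    "'a measure \<Rightarrow> ('a \<Rightarrow> real) set \<Rightarrow> (('a \<Rightarrow> real) \<Rightarrow> ('a \<Rightarrow> real) \<Rightarrow> real) \<Rightarrow> real \<Rightarrow>
     ('a \<Rightarrow> real) set" where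
  "Vq_space M F E q = Lq_space M q \<inter> extended_domain M F E"

definition Vq_norm ::
    "'a measure \<Rightarrow> ('a \<Rightarrow> real) set \<Rightarrow> (('a \<Rightarrow> real) \<Rightarrow> ('a \<Rightarrow> real) \<Rightarrow> real) \<Rightarrow> real \<Rightarrow>
     ('a \<Rightarrow> real) \<Rightarrow> real" where
  "Vq_norm M F E q u = sqrt ((Lq_norm M q u)\<^sup>2 + extended_energy M F E u)"

end

theory Submission
  imports Defs
begin

text \<open>
  The norm combines the \<open>L\<^sup>q\<close> norm with the seminorm \<open>sqrt (E u u)\<close> on the extended Dirichlet
  space, and completeness follows from the completeness of both parts once their limits are
  matched. A Cauchy sequence converges in \<open>L\<^sup>q\<close>, and a subsequence of it converges almost
  everywhere to the same function \<open>u\<close>. Each term of the subsequence is approximated by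
  functions of the domain \<open>F\<close>; choosing these close enough in energy and, by sigma-finiteness,
  close enough in measure, one obtains a diagonal sequence in \<open>F\<close> that is Cauchy for the energy
  and tends to \<open>u\<close> almost everywhere (\<open>AE_diagonal_subsequence\<close>). This is what membership of
  \<open>u\<close> in the extended space means, and the diagonal sequence tends to \<open>u\<close> in energy
  (\<open>extended_complete\<close>).

  All this requires the extended energy to be well defined and a seminorm. Well-definedness is
  the main analytic point: if \<open>w k \<in> F\<close> has Cauchy energy and tends to 0 almost everywhere, then
  \<open>E (w k) (w k)\<close> tends to 0 (\<open>null_sequence_energy\<close>). It follows from a Fatou property: if
  \<open>w k\<close> tends to \<open>u \<in> F\<close> almost everywhere with energies at most \<open>D\<close>, then \<open>E u u \<le> 4 * D\<close>
  (\<open>energy_le_of_AE_limit\<close>); this is applied to \<open>w j - w k\<close> as \<open>k\<close> tends to infinity.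

  For the Fatou property the functions are truncated to \<open>[0, c]\<close>, which does not increase the
  energy by the Markov property. The truncations converge almost everywhere and boundedly, hence
  weakly against integrable functions, but they need not be bounded in \<open>L\<^sup>2\<close>. That this still
  implies weak convergence with respect to \<open>E\<close> is shown by testing with resolvents. If \<open>g\<close> is
  the resolvent of \<open>f\<close> at 1, then \<open>E z g = \<integral> z (f - g)\<close>; for \<open>f\<close> in \<open>L\<^sup>1\<close> and \<open>L\<^sup>2\<close>, the resolvent is
  integrable again by the Markov property (\<open>resolvent_integrable\<close>); and such resolvents are
  dense in \<open>F\<close> (\<open>weakly_null_if_null_against_L1_L2\<close>). Resolvents and density both come from the
  Riesz representation theorem, proved by minimising a quadratic functional.
\<close>

section \<open>Passing between representatives and classes\<close>

text \<open>
  The closure and invariance conditions under which the operations on representatives descend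
  to \<open>V // ae_eq M\<close>. They let the Banach space axioms for classes be read off from, and be
  proved by, statements about functions.
\<close>

locale ae_function_space =
  fixes M :: "'a measure"
    and V :: "('a \<Rightarrow> real) set"
    and N :: "('a \<Rightarrow> real) \<Rightarrow> real"
  assumes meas: "u \<in> V \<Longrightarrow> u \<in> borel_measurable M"
    and ae_closed: "u \<in> V \<Longrightarrow> v \<in> borel_measurable M \<Longrightarrow> (AE x in M. u x = v x) \<Longrightarrow> v \<in> V"
    and zero_mem: "(\<lambda>x. 0) \<in> V"
    and add_mem: "u \<in> V \<Longrightarrow> v \<in> V \<Longrightarrow> (\<lambda>x. u x + v x) \<in> V"
    and scale_mem: "u \<in> V \<Longrightarrow> (\<lambda>x. c * u x) \<in> V"
    and norm_ae: "u \<in> V \<Longrightarrow> v \<in> V \<Longrightarrow> (AE x in M. u x = v x) \<Longrightarrow> N u = N v"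
begin

abbreviation cls :: "('a \<Rightarrow> real) \<Rightarrow> ('a \<Rightarrow> real) set" where
  "cls u \<equiv> ae_eq M `` {u}"

lemma ae_eq_iff: "u \<in> V \<Longrightarrow> (u, v) \<in> ae_eq M \<longleftrightarrow> v \<in> V \<and> (AE x in M. u x = v x)"
  unfolding ae_eq_def using ae_closed[of u v] meas[of u] meas[of v] by blast

lemma cls_self: "u \<in> V \<Longrightarrow> u \<in> cls u"
  by (simp add: ae_eq_iff)

lemma cls_eq_iff:
  assumes "u \<in> V" "v \<in> V"
  shows "cls u = cls v \<longleftrightarrow> (AE x in M. u x = v x)"
proof
  assume "cls u = cls v"
  with assms cls_self[of v] have "v \<in> cls u" by metis
  with assms show "AE x in M. u x = v x" by (simp add: ae_eq_iff)
next
  assume uv: "AE x in M. u x = v x"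
  have "(AE x in M. u x = w x) \<longleftrightarrow> (AE x in M. v x = w x)" for w
    using uv by (intro iffI; elim AE_mp) auto
  then show "cls u = cls v" using assms by (auto simp: ae_eq_iff)
qed

lemma cls_scale:
  assumes "u \<in> V"
  shows "ae_scale M c (cls u) = cls (\<lambda>x. c * u x)"
proof -
  have "cls (\<lambda>x. c * w x) = cls (\<lambda>x. c * u x)" if "w \<in> cls u" for w
  proof -
    have w: "w \<in> V" "AE x in M. u x = w x" using that assms by (auto simp: ae_eq_iff)
    have "AE x in M. c * w x = c * u x" using w(2) by eventually_elim simp
    then show ?thesis using assms w scale_mem cls_eq_iff by metis
  qed
  then show ?thesis unfolding ae_scale_def using cls_self[OF assms] by blast
qed

lemma cls_add:
  assumes "u \<in> V" "v \<in> V"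
  shows "ae_add M (cls u) (cls v) = cls (\<lambda>x. u x + v x)"
proof -
  have "cls (\<lambda>x. u' x + v' x) = cls (\<lambda>x. u x + v x)" if "u' \<in> cls u" "v' \<in> cls v" for u' v'
  proof -
    have w: "u' \<in> V" "AE x in M. u x = u' x" "v' \<in> V" "AE x in M. v x = v' x"
      using that assms by (auto simp: ae_eq_iff)
    have "AE x in M. u' x + v' x = u x + v x" using w(2,4) by eventually_elim simp
    then show ?thesis using assms w add_mem cls_eq_iff by metis
  qed
  then show ?thesis unfolding ae_add_def using cls_self assms by blast
qed

lemma cls_norm:
  assumes "u \<in> V"
  shows "ae_norm N (cls u) = N u"
proof -
  have "N v = N u" if "v \<in> cls u" for v
    using that assms norm_ae[of u v] by (simp add: ae_eq_iff)
  then have "N ` cls u = {N u}"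
    using cls_self[OF assms] by blast
  then show ?thesis by (simp add: ae_norm_def)
qed

lemma cls_diff:
  assumes "u \<in> V" "v \<in> V"
  shows "ae_add M (cls u) (ae_scale M (- 1) (cls v)) = cls (\<lambda>x. u x - v x)"
  using cls_add[OF assms(1) scale_mem[OF assms(2), of "-1"]] cls_scale[OF assms(2), of "-1"] by simp

lemma diff_mem: "u \<in> V \<Longrightarrow> v \<in> V \<Longrightarrow> (\<lambda>x. u x - v x) \<in> V"
  using add_mem[of u "\<lambda>x. -1 * v x"] scale_mem[of v "-1"] by simp

lemma completeD:
  assumes ban: "ae_banach M V N"
    and s: "\<And>n. s n \<in> V"
    and cau: "\<And>e. e > 0 \<Longrightarrow> \<exists>k. \<forall>m\<ge>k. \<forall>n\<ge>k. N (\<lambda>x. s m x - s n x) < e"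
  shows "\<exists>u\<in>V. (\<lambda>n. N (\<lambda>x. s n x - u x)) \<longlonglongrightarrow> 0"
proof -
  have "\<exists>X\<in>V // ae_eq M. (\<lambda>n. ae_norm N (ae_add M (cls (s n)) (ae_scale M (- 1) X))) \<longlonglongrightarrow> 0"
    using ban unfolding ae_banach_def
    by (rule banach_on.complete)
       (use s cau in \<open>auto intro: quotientI simp: cls_diff diff_mem cls_norm\<close>)
  then obtain u where "u \<in> V"
      "(\<lambda>n. ae_norm N (ae_add M (cls (s n)) (ae_scale M (- 1) (cls u)))) \<longlonglongrightarrow> 0"
    by (auto elim!: quotientE)
  then show ?thesis using s by (auto simp: cls_diff diff_mem cls_norm)
qed

lemma ae_banachI:
  assumes nonneg: "\<And>u. u \<in> V \<Longrightarrow> 0 \<le> N u"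
    and zero: "N (\<lambda>x. 0) = 0"
    and definite: "\<And>u. u \<in> V \<Longrightarrow> N u = 0 \<Longrightarrow> AE x in M. u x = 0"
    and hom: "\<And>u c. u \<in> V \<Longrightarrow> N (\<lambda>x. c * u x) = \<bar>c\<bar> * N u"
    and tri: "\<And>u v. u \<in> V \<Longrightarrow> v \<in> V \<Longrightarrow> N (\<lambda>x. u x + v x) \<le> N u + N v"
    and complete: "\<And>s. (\<And>n. s n \<in> V) \<Longrightarrow>
       (\<And>e. e > 0 \<Longrightarrow> \<exists>k. \<forall>m\<ge>k. \<forall>n\<ge>k. N (\<lambda>x. s m x - s n x) < e) \<Longrightarrow>
       \<exists>u\<in>V. (\<lambda>n. N (\<lambda>x. s n x - u x)) \<longlonglongrightarrow> 0"
  shows "ae_banach M V N"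
proof -
  have ex: "\<exists>u\<in>V. X = cls u" if "X \<in> V // ae_eq M" for X
    using that by (auto elim: quotientE)
  have q: "cls u \<in> V // ae_eq M" if "u \<in> V" for u
    using that by (rule quotientI)
  have z: "ae_zero M = cls (\<lambda>x. 0)" by (simp add: ae_zero_def)
  note simps = cls_add cls_scale cls_norm cls_diff add_mem scale_mem diff_mem zero_mem
  show ?thesis
    unfolding ae_banach_def
  proof
    show "ae_zero M \<in> V // ae_eq M" unfolding z by (rule q[OF zero_mem])
  next
    fix X Y assume "X \<in> V // ae_eq M" "Y \<in> V // ae_eq M"
    then obtain u v where uv: "u \<in> V" "v \<in> V" "X = cls u" "Y = cls v" using ex by metis
    then show "ae_add M X Y \<in> V // ae_eq M" by (simp add: simps q)
    show "ae_add M X Y = ae_add M Y X" using uv by (simp add: simps add.commute)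
    show "ae_scale M c (ae_add M X Y) = ae_add M (ae_scale M c X) (ae_scale M c Y)" for c
      using uv by (simp add: simps distrib_left)
    show "ae_norm N (ae_add M X Y) \<le> ae_norm N X + ae_norm N Y"
      using uv by (simp add: simps tri)
    fix Z assume "Z \<in> V // ae_eq M"
    then obtain w where "w \<in> V" "Z = cls w" using ex by metis
    with uv show "ae_add M (ae_add M X Y) Z = ae_add M X (ae_add M Y Z)"
      by (simp add: simps add.assoc)
  next
    fix X assume "X \<in> V // ae_eq M"
    then obtain u where u: "u \<in> V" "X = cls u" using ex by metis
    show "ae_scale M c X \<in> V // ae_eq M" for c using u by (simp add: simps q)
    show "ae_add M (ae_zero M) X = X" using u by (simp add: z simps)
    show "ae_add M X (ae_scale M (- 1) X) = ae_zero M" using u by (simp add: z cls_diff)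
    show "ae_scale M (c + d) X = ae_add M (ae_scale M c X) (ae_scale M d X)" for c d
      using u by (simp add: simps distrib_right)
    show "ae_scale M c (ae_scale M d X) = ae_scale M (c * d) X" for c d
      using u by (simp add: simps mult.assoc)
    show "ae_scale M 1 X = X" using u by (simp add: simps)
    show "0 \<le> ae_norm N X" using u by (simp add: simps nonneg)
    show "ae_norm N X = 0 \<longleftrightarrow> X = ae_zero M"
    proof -
      have "N u = 0" if "AE x in M. u x = 0"
        using norm_ae[OF u(1) zero_mem] that zero by simp
      then show ?thesis
        using u definite by (auto simp: z simps cls_eq_iff)
    qed
    show "ae_norm N (ae_scale M c X) = \<bar>c\<bar> * ae_norm N X" for c
      using u by (simp add: simps hom)
  next
    fix S :: "nat \<Rightarrow> ('a \<Rightarrow> real) set"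
    assume S: "\<And>n. S n \<in> V // ae_eq M"
      and cau: "\<And>e. e > 0 \<Longrightarrow> \<exists>k. \<forall>m\<ge>k. \<forall>n\<ge>k.
        ae_norm N (ae_add M (S m) (ae_scale M (- 1) (S n))) < e"
    obtain s where s: "\<And>n. s n \<in> V" "\<And>n. S n = cls (s n)" using ex[OF S] by metis
    have "ae_norm N (ae_add M (S m) (ae_scale M (- 1) (S n))) = N (\<lambda>x. s m x - s n x)" for m n
      using s by (simp add: cls_diff diff_mem cls_norm)
    with complete[of s] s cau obtain u where "u \<in> V" "(\<lambda>n. N (\<lambda>x. s n x - u x)) \<longlonglongrightarrow> 0"
      by auto
    then show "\<exists>X\<in>V // ae_eq M. (\<lambda>n. ae_norm N (ae_add M (S n) (ae_scale M (- 1) X))) \<longlonglongrightarrow> 0"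
      using s by (intro bexI[of _ "cls u"]) (auto simp: cls_diff diff_mem cls_norm q)
  qed
qed

end

text \<open>
  A Cauchy sequence that has a convergent subsequence converges. Here \<open>d n k\<close> stands for the
  distance of the terms \<open>n\<close> and \<open>k\<close>, and \<open>e n\<close> for the distance of the term \<open>n\<close> to the limit,
  so the fact applies to any seminorm.
\<close>

lemma cauchy_tendsto_zero_if_subseq:
  fixes d :: "nat \<Rightarrow> nat \<Rightarrow> real"
  assumes nonneg: "\<And>n. 0 \<le> e n"
    and tri: "\<And>n k. e n \<le> d n k + e k"
    and cau: "\<And>a. a > 0 \<Longrightarrow> \<exists>N. \<forall>m\<ge>N. \<forall>n\<ge>N. d m n < a"
    and r: "strict_mono (r :: nat \<Rightarrow> nat)"
    and lim: "(\<lambda>k. e (r k)) \<longlonglongrightarrow> 0"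
  shows "e \<longlonglongrightarrow> 0"
proof (rule LIMSEQ_I)
  fix a :: real assume a: "a > 0"
  obtain N where N: "\<And>m n. m \<ge> N \<Longrightarrow> n \<ge> N \<Longrightarrow> d m n < a / 2"
    using cau[of "a/2"] a by auto
  have "\<forall>\<^sub>F k in sequentially. e (r k) < a / 2"
    using order_tendstoD(2)[OF lim, of "a/2"] a by simp
  then obtain K where K: "\<And>k. k \<ge> K \<Longrightarrow> e (r k) < a / 2"
    by (auto simp: eventually_sequentially)
  define k where "k = max K N"
  have rk: "r k \<ge> N" using seq_suble[OF r, of k] by (simp add: k_def)
  have "norm (e n - 0) < a" if "n \<ge> N" for n
    using nonneg[of n] tri[of n "r k"] N[OF that rk] K[of k] by (simp add: k_def)
  then show "\<exists>no. \<forall>n\<ge>no. norm (e n - 0) < a" by blast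
qed

section \<open>The spaces of q-integrable functions\<close>

text \<open>
  Fatou's lemma in the form in which it yields lower semicontinuity of norms: the limit is
  integrable because its upper integral is at most \<open>C\<close>.
\<close>

lemma Fatou_real:
  fixes f :: "nat \<Rightarrow> 'a \<Rightarrow> real"
  assumes int: "\<And>n. integrable M (f n)" and nonneg: "\<And>n x. 0 \<le> f n x"
    and lim: "AE x in M. (\<lambda>n. f n x) \<longlonglongrightarrow> g x"
    and g: "g \<in> borel_measurable M"
    and bound: "\<forall>\<^sub>F n in sequentially. (\<integral>x. f n x \<partial>M) \<le> C"
  shows "integrable M g" and "(\<integral>x. g x \<partial>M) \<le> C"
proof -
  note [measurable] = g borel_measurable_integrable[OF int]
  have g0: "AE x in M. 0 \<le> g x"
    using lim by eventually_elim (auto intro: LIMSEQ_le_const nonneg)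
  from bound obtain N where "(\<integral>x. f N x \<partial>M) \<le> C" by (auto simp: eventually_sequentially)
  then have C: "0 \<le> C"
    using integral_nonneg_AE[of "f N" M] nonneg by fastforce
  have "(\<integral>\<^sup>+x. ennreal (g x) \<partial>M) = (\<integral>\<^sup>+x. liminf (\<lambda>n. ennreal (f n x)) \<partial>M)"
  proof (rule nn_integral_cong_AE)
    show "AE x in M. ennreal (g x) = liminf (\<lambda>n. ennreal (f n x))"
      using lim
    proof eventually_elim
      case (elim x)
      then have "(\<lambda>n. ennreal (f n x)) \<longlonglongrightarrow> ennreal (g x)" by (rule tendsto_ennrealI)
      then show ?case using lim_imp_Liminf[OF sequentially_bot] by metis
    qed
  qed
  also have "\<dots> \<le> liminf (\<lambda>n. \<integral>\<^sup>+x. ennreal (f n x) \<partial>M)"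
    by (rule nn_integral_liminf) measurable
  also have "\<dots> \<le> ennreal C"
  proof (rule Liminf_le)
    show "\<forall>\<^sub>F n in sequentially. (\<integral>\<^sup>+x. ennreal (f n x) \<partial>M) \<le> ennreal C"
      using bound
    proof eventually_elim
      case (elim n)
      then show ?case using nn_integral_eq_integral[OF int[of n]] nonneg by (simp add: ennreal_leI)
    qed
  qed simp
  finally have le: "(\<integral>\<^sup>+x. ennreal (g x) \<partial>M) \<le> ennreal C" .
  show ig: "integrable M g"
    using le g0 by (intro integrableI_nonneg g) (auto simp: top.not_eq_extremum intro: le_less_trans)
  show "(\<integral>x. g x \<partial>M) \<le> C"
    using le C nn_integral_eq_integral[OF ig g0] by simp
qed

lemma powr_convex_combination:
  fixes a b l q :: real
  assumes "1 \<le> q" "0 \<le> a" "0 \<le> b" "0 < l" "l < 1"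
  shows "((1 - l) * a + l * b) powr q \<le> (1 - l) * a powr q + l * b powr q"
proof -
  have small: "(t * c) powr q \<le> t * c powr q" if "0 < t" "t < 1" "0 \<le> c" for t c :: real
  proof -
    have "t powr q \<le> t powr 1" using that assms by (intro powr_mono') auto
    then show ?thesis using that by (simp add: powr_mult mult_right_mono)
  qed
  consider "a = 0" | "b = 0" | "0 < a" "0 < b" using assms by linarith
  then show ?thesis
  proof cases
    case 1 then show ?thesis using small[of l b] assms by simp
  next
    case 2 then show ?thesis using small[of "1 - l" a] assms by simp
  next
    case 3
    then show ?thesis using convex_onD[OF powr_convex[OF assms(1)], of l a b] assms by simp
  qed
qed

lemma Lq_space_measurable: "u \<in> Lq_space M q \<Longrightarrow> u \<in> borel_measurable M"
  by (simp add: Lq_space_def)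

lemma Lq_space_integrable: "u \<in> Lq_space M q \<Longrightarrow> integrable M (\<lambda>x. \<bar>u x\<bar> powr q)"
  by (simp add: Lq_space_def)

lemma Lq_norm_nonneg: "0 \<le> Lq_norm M q u"
  by (simp add: Lq_norm_def)

lemma Lq_norm_powr:
  assumes "0 < q"
  shows "Lq_norm M q u powr q = (\<integral>x. \<bar>u x\<bar> powr q \<partial>M)"
  using assms by (simp add: Lq_norm_def powr_powr)

lemma Lq_norm_le_iff:
  assumes "0 < q" "0 \<le> C"
  shows "Lq_norm M q u \<le> C \<longleftrightarrow> (\<integral>x. \<bar>u x\<bar> powr q \<partial>M) \<le> C powr q"
  using assms Lq_norm_nonneg[of M q u]
  unfolding Lq_norm_powr[OF assms(1), symmetric]
  by (metis not_le powr_less_mono2 powr_mono2 less_imp_le)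

lemma Lq_space_ae:
  assumes "u \<in> Lq_space M q" "v \<in> borel_measurable M" "AE x in M. u x = v x"
  shows "v \<in> Lq_space M q"
proof -
  have "integrable M (\<lambda>x. \<bar>v x\<bar> powr q)"
  proof (rule Bochner_Integration.integrable_cong_AE_imp[OF Lq_space_integrable[OF assms(1)]])
    show "(\<lambda>x. \<bar>v x\<bar> powr q) \<in> borel_measurable M" using assms by measurable
    show "AE x in M. \<bar>u x\<bar> powr q = \<bar>v x\<bar> powr q" using assms(3) by auto
  qed
  then show ?thesis using assms by (simp add: Lq_space_def)
qed

lemma Lq_norm_ae:
  assumes "u \<in> borel_measurable M" "v \<in> borel_measurable M" "AE x in M. u x = v x"
  shows "Lq_norm M q u = Lq_norm M q v"
proof -
  have "(\<integral>x. \<bar>u x\<bar> powr q \<partial>M) = (\<integral>x. \<bar>v x\<bar> powr q \<partial>M)"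
  proof (rule integral_cong_AE)
    show "AE x in M. \<bar>u x\<bar> powr q = \<bar>v x\<bar> powr q" using assms(3) by auto
  qed (use assms in measurable)
  then show ?thesis by (simp add: Lq_norm_def)
qed

lemma Lq_space_zero: "0 < q \<Longrightarrow> (\<lambda>x. 0) \<in> Lq_space M q"
  by (simp add: Lq_space_def)

lemma Lq_norm_eq_zero:
  assumes "0 < q" "u \<in> Lq_space M q" "Lq_norm M q u = 0"
  shows "AE x in M. u x = 0"
proof -
  have "(\<integral>x. \<bar>u x\<bar> powr q \<partial>M) = 0"
    using Lq_norm_powr[OF assms(1), of M u] assms by simp
  then have "AE x in M. \<bar>u x\<bar> powr q = 0"
    using integral_nonneg_eq_0_iff_AE[OF Lq_space_integrable[OF assms(2)]] by simp
  then show ?thesis by simp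
qed

lemma Lq_space_scale: "u \<in> Lq_space M q \<Longrightarrow> (\<lambda>x. c * u x) \<in> Lq_space M q"
  by (auto simp: Lq_space_def abs_mult powr_mult)

lemma Lq_norm_scale:
  assumes "0 < q"
  shows "Lq_norm M q (\<lambda>x. c * u x) = \<bar>c\<bar> * Lq_norm M q u"
  using assms by (simp add: Lq_norm_def abs_mult powr_mult powr_powr)

lemma Lq_space_add:
  assumes q: "1 \<le> q" and u: "u \<in> Lq_space M q" and v: "v \<in> Lq_space M q"
  shows "(\<lambda>x. u x + v x) \<in> Lq_space M q"
proof -
  note [measurable] = u[THEN Lq_space_measurable] v[THEN Lq_space_measurable]
  have le: "\<bar>u x + v x\<bar> powr q \<le> 2 powr q * (\<bar>u x\<bar> powr q + \<bar>v x\<bar> powr q)" for x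
  proof -
    have "\<bar>u x + v x\<bar> powr q \<le> (2 * max \<bar>u x\<bar> \<bar>v x\<bar>) powr q"
      using q by (intro powr_mono2) auto
    also have "\<dots> = 2 powr q * max \<bar>u x\<bar> \<bar>v x\<bar> powr q" by (simp add: powr_mult)
    also have "\<dots> \<le> 2 powr q * (\<bar>u x\<bar> powr q + \<bar>v x\<bar> powr q)" by (simp add: max_def)
    finally show ?thesis .
  qed
  have "integrable M (\<lambda>x. \<bar>u x + v x\<bar> powr q)"
  proof (rule Bochner_Integration.integrable_bound)
    show "integrable M (\<lambda>x. 2 powr q * (\<bar>u x\<bar> powr q + \<bar>v x\<bar> powr q))"
      using u v by (auto simp: Lq_space_def)
    show "AE x in M. norm (\<bar>u x + v x\<bar> powr q) \<le> norm (2 powr q * (\<bar>u x\<bar> powr q + \<bar>v x\<bar> powr q))"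
      using le by (intro AE_I2) (simp add: abs_mult)
  qed measurable
  then show ?thesis by (simp add: Lq_space_def)
qed

lemma Lq_space_diff:
  assumes q: "1 \<le> q" and u: "u \<in> Lq_space M q" and v: "v \<in> Lq_space M q"
  shows "(\<lambda>x. u x - v x) \<in> Lq_space M q"
  using Lq_space_add[OF q u Lq_space_scale[OF v, of "-1"]] by simp

text \<open>
  Minkowski's inequality: dividing by the norms, the sum is a convex combination of two
  functions in the unit ball, with weights proportional to the norms, and
  \<open>t \<mapsto> t powr q\<close> is convex.
\<close>

lemma Lq_norm_triangle:
  assumes q: "1 \<le> q" and u: "u \<in> Lq_space M q" and v: "v \<in> Lq_space M q"
  shows "Lq_norm M q (\<lambda>x. u x + v x) \<le> Lq_norm M q u + Lq_norm M q v"
proof -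
  have q0: "0 < q" using q by simp
  note um [measurable] = u[THEN Lq_space_measurable]
  note vm [measurable] = v[THEN Lq_space_measurable]
  let ?a = "Lq_norm M q u" and ?b = "Lq_norm M q v"
  consider "?a = 0" | "?b = 0" | "0 < ?a" "0 < ?b"
    using Lq_norm_nonneg[of M q u] Lq_norm_nonneg[of M q v] by linarith
  then show ?thesis
  proof cases
    case 1
    then have "AE x in M. u x = 0" by (rule Lq_norm_eq_zero[OF q0 u])
    then have "AE x in M. u x + v x = v x" by auto
    then have "Lq_norm M q (\<lambda>x. u x + v x) = ?b"
      by (intro Lq_norm_ae) measurable
    then show ?thesis using 1 by simp
  next
    case 2
    then have "AE x in M. v x = 0" by (rule Lq_norm_eq_zero[OF q0 v])
    then have "AE x in M. u x + v x = u x" by auto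
    then have "Lq_norm M q (\<lambda>x. u x + v x) = ?a"
      by (intro Lq_norm_ae) measurable
    then show ?thesis using 2 by simp
  next
    case 3
    define s where "s = ?a + ?b"
    define l where "l = ?b / s"
    have s: "s > 0" "0 < l" "l < 1" "1 - l = ?a / s"
      using 3 by (auto simp: s_def l_def field_simps)
    have pt: "\<bar>u x + v x\<bar> powr q \<le>
        s powr q * ((1 - l) / ?a powr q * \<bar>u x\<bar> powr q + l / ?b powr q * \<bar>v x\<bar> powr q)" for x
    proof -
      have "\<bar>u x + v x\<bar> \<le> s * ((1 - l) * (\<bar>u x\<bar> / ?a) + l * (\<bar>v x\<bar> / ?b))"
      proof -
        have "s * (1 - l) = ?a" "s * l = ?b" using s by (auto simp: l_def)
        then have "s * ((1 - l) * (\<bar>u x\<bar> / ?a) + l * (\<bar>v x\<bar> / ?b)) =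
            ?a * (\<bar>u x\<bar> / ?a) + ?b * (\<bar>v x\<bar> / ?b)"
          by (simp only: distrib_left mult.assoc[symmetric])
        then show ?thesis using 3 by simp
      qed
      then have "\<bar>u x + v x\<bar> powr q \<le> (s * ((1 - l) * (\<bar>u x\<bar> / ?a) + l * (\<bar>v x\<bar> / ?b))) powr q"
        using q by (intro powr_mono2) auto
      also have "\<dots> = s powr q * ((1 - l) * (\<bar>u x\<bar> / ?a) + l * (\<bar>v x\<bar> / ?b)) powr q"
        by (rule powr_mult)
      also have "\<dots> \<le> s powr q * ((1 - l) * (\<bar>u x\<bar> / ?a) powr q + l * (\<bar>v x\<bar> / ?b) powr q)"
        using 3 s q by (intro mult_left_mono powr_convex_combination) auto
      finally show ?thesis by (simp add: powr_divide Lq_norm_nonneg)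
    qed
    have "(\<integral>x. \<bar>u x + v x\<bar> powr q \<partial>M) \<le>
        (\<integral>x. s powr q * ((1 - l) / ?a powr q * \<bar>u x\<bar> powr q + l / ?b powr q * \<bar>v x\<bar> powr q) \<partial>M)"
      by (rule integral_mono[OF _ _ pt])
         (use u v Lq_space_add[OF q u v] in \<open>auto simp: Lq_space_def\<close>)
    also have "\<dots> = s powr q * ((1 - l) / ?a powr q * ?a powr q + l / ?b powr q * ?b powr q)"
      using u v by (simp add: Lq_space_def Lq_norm_powr[OF q0])
    also have "\<dots> = s powr q" using 3 by simp
    finally show ?thesis
      using s by (simp add: Lq_norm_le_iff[OF q0] s_def)
  qed
qed

text \<open>
  A sequence whose consecutive distances decay like \<open>1 / 4 ^ k\<close> converges almost everywhere:
  the series of the functions \<open>(2 ^ k * d k) powr q\<close>, where \<open>d k\<close> are the absolute consecutive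
  differences, has finite integral, so it is finite almost everywhere, and there
  \<open>d k \<le> C / 2 ^ k\<close>.
\<close>

lemma Lq_fast_cauchy_AE_convergent:
  assumes q: "1 \<le> q" and s: "\<And>k. s k \<in> Lq_space M q"
    and fast: "\<And>k. Lq_norm M q (\<lambda>x. s (Suc k) x - s k x) \<le> (1/4) ^ k"
  shows "AE x in M. convergent (\<lambda>k. s k x)"
proof -
  have q0: "0 < q" using q by simp
  note [measurable] = s[THEN Lq_space_measurable]
  define f where "f k x = (2 ^ k * \<bar>s (Suc k) x - s k x\<bar>) powr q" for k x
  have [measurable]: "f k \<in> borel_measurable M" for k unfolding f_def by measurable
  have f_alt: "f k x = (2 ^ k) powr q * \<bar>s (Suc k) x - s k x\<bar> powr q" for k x
    by (simp add: f_def powr_mult)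
  have fint: "integrable M (f k)" for k
    using Lq_space_integrable[OF Lq_space_diff[OF q s s]] by (simp add: f_alt[abs_def])
  have fle: "(\<integral>x. f k x \<partial>M) \<le> (1/2) ^ k" for k
  proof -
    have "(\<integral>x. f k x \<partial>M) = (2 ^ k) powr q * Lq_norm M q (\<lambda>x. s (Suc k) x - s k x) powr q"
      by (simp add: f_alt Lq_norm_powr[OF q0])
    also have "\<dots> \<le> (2 ^ k) powr q * ((1/4) ^ k) powr q"
      using q by (intro mult_left_mono powr_mono2 fast Lq_norm_nonneg) auto
    also have "\<dots> = ((1/2) ^ k) powr q"
      by (simp add: powr_mult[symmetric] power_mult_distrib[symmetric])
    also have "\<dots> \<le> ((1/2) ^ k) powr 1"
      using q by (intro powr_mono') (auto simp: power_le_one)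
    finally show ?thesis by simp
  qed
  have fnn: "(\<integral>\<^sup>+x. ennreal (f k x) \<partial>M) = ennreal (\<integral>x. f k x \<partial>M)" for k
    by (rule nn_integral_eq_integral[OF fint]) (simp add: f_def)
  have "(\<integral>\<^sup>+x. (\<Sum>k. ennreal (f k x)) \<partial>M) = (\<Sum>k. \<integral>\<^sup>+x. ennreal (f k x) \<partial>M)"
    by (rule nn_integral_suminf) measurable
  also have "\<dots> = (\<Sum>k. ennreal (\<integral>x. f k x \<partial>M))"
    by (simp only: fnn)
  also have "\<dots> \<le> (\<Sum>k. ennreal ((1/2) ^ k))"
    by (intro suminf_le ennreal_leI fle) auto
  also have "\<dots> = ennreal (\<Sum>k. (1/2) ^ k)"
    by (rule suminf_ennreal2) (auto intro: summable_geometric)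
  also have "\<dots> < \<infinity>" by simp
  finally have "AE x in M. (\<Sum>k. ennreal (f k x)) \<noteq> \<infinity>"
    by (intro nn_integral_noteq_infinite) auto
  then show ?thesis
  proof eventually_elim
    case (elim x)
    obtain C where C: "(\<Sum>k. ennreal (f k x)) = ennreal C" "C \<ge> 0"
      using elim by (cases "(\<Sum>k. ennreal (f k x))") auto
    have "norm (s (Suc k) x - s k x) \<le> C powr (1/q) * (1/2) ^ k" for k
    proof -
      have "ennreal (f k x) \<le> (\<Sum>k. ennreal (f k x))"
        using sum_le_suminf[of "\<lambda>k. ennreal (f k x)" "{k}"] by simp
      then have "f k x \<le> C" using C by simp
      then have "f k x powr (1/q) \<le> C powr (1/q)"
        using q by (intro powr_mono2) (auto simp: f_def)
      then have "2 ^ k * \<bar>s (Suc k) x - s k x\<bar> \<le> C powr (1/q)"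
        using q by (simp add: f_def powr_powr)
      then show ?thesis by (simp add: field_simps power_divide)
    qed
    then have "summable (\<lambda>k. s (Suc k) x - s k x)"
      by (intro summable_comparison_test'[where N = 0, OF summable_mult[OF summable_geometric]]) auto
    then have "convergent (\<lambda>n. (\<Sum>k<n. s (Suc k) x - s k x) + s 0 x)"
      by (intro convergent_add convergent_const) (simp add: summable_iff_convergent)
    then show ?case by (simp add: sum_lessThan_telescope[of "\<lambda>k. s k x"])
  qed
qed

text \<open>
  A subsequence with fast decaying distances converges almost everywhere by the previous lemma.
  Fatou's lemma, applied to the differences with a fixed term, turns this limit into the limit
  in the norm. The subsequence is part of the result because limits in the extended Dirichlet
  space are determined by convergence almost everywhere.
\<close>

lemma Lq_complete:
  assumes q: "1 \<le> q" and s: "\<And>n. s n \<in> Lq_space M q"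
    and cau: "\<And>e. e > 0 \<Longrightarrow> \<exists>k. \<forall>m\<ge>k. \<forall>n\<ge>k. Lq_norm M q (\<lambda>x. s m x - s n x) < e"
  obtains u r where "u \<in> Lq_space M q" "(\<lambda>n. Lq_norm M q (\<lambda>x. s n x - u x)) \<longlonglongrightarrow> 0"
    "strict_mono (r :: nat \<Rightarrow> nat)" "AE x in M. (\<lambda>k. s (r k) x) \<longlonglongrightarrow> u x"
proof -
  have q0: "0 < q" using q by simp
  note sm [measurable] = s[THEN Lq_space_measurable]
  have "\<forall>k. \<exists>N. \<forall>m\<ge>N. \<forall>n\<ge>N. Lq_norm M q (\<lambda>x. s m x - s n x) < (1/4) ^ k"
    using cau by simp
  then obtain N where N: "\<And>k m n. m \<ge> N k \<Longrightarrow> n \<ge> N k \<Longrightarrow>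
      Lq_norm M q (\<lambda>x. s m x - s n x) < (1/4) ^ k"
    by metis
  \<comment> \<open>The partial sums make \<open>r\<close> strictly increasing and keep \<open>r k \<ge> N k\<close>.\<close>
  define r where "r k = (\<Sum>i\<le>k. Suc (N i))" for k
  have r: "strict_mono r" by (rule strict_mono_Suc_iff[THEN iffD2]) (simp add: r_def)
  have rN: "r k \<ge> N k" for k by (cases k) (auto simp: r_def)
  have "AE x in M. convergent (\<lambda>k. s (r k) x)"
  proof (rule Lq_fast_cauchy_AE_convergent[OF q s])
    fix k
    have "r (Suc k) \<ge> N k" using rN[of k] strict_monoD[OF r, of k "Suc k"] by simp
    then show "Lq_norm M q (\<lambda>x. s (r (Suc k)) x - s (r k) x) \<le> (1/4) ^ k"
      using N[OF _ rN] by (simp add: less_imp_le)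
  qed
  define u where "u x = lim (\<lambda>k. s (r k) x)" for x
  have um [measurable]: "u \<in> borel_measurable M" unfolding u_def by measurable
  have lim: "AE x in M. (\<lambda>k. s (r k) x) \<longlonglongrightarrow> u x"
    using \<open>AE x in M. convergent (\<lambda>k. s (r k) x)\<close> by (simp add: u_def convergent_LIMSEQ_iff)
  have est: "integrable M (\<lambda>x. \<bar>s n x - u x\<bar> powr q) \<and> Lq_norm M q (\<lambda>x. s n x - u x) \<le> (1/4) ^ k"
    if n: "n \<ge> N k" for n k
  proof -
    have ev: "\<forall>\<^sub>F j in sequentially. (\<integral>x. \<bar>s n x - s (r j) x\<bar> powr q \<partial>M) \<le> ((1/4) ^ k) powr q"
    proof (rule eventually_sequentiallyI)
      fix j assume "j \<ge> N k"
      then have "r j \<ge> N k" using seq_suble[OF r, of j] by simp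
      then have "Lq_norm M q (\<lambda>x. s n x - s (r j) x) \<le> (1/4) ^ k" using N[OF n] by (simp add: less_imp_le)
      then show "(\<integral>x. \<bar>s n x - s (r j) x\<bar> powr q \<partial>M) \<le> ((1/4) ^ k) powr q"
        by (simp add: Lq_norm_le_iff[OF q0])
    qed
    have li: "AE x in M. (\<lambda>j. \<bar>s n x - s (r j) x\<bar> powr q) \<longlonglongrightarrow> \<bar>s n x - u x\<bar> powr q"
      using lim
    proof eventually_elim
      case (elim x)
      then show ?case using q0 by (intro tendsto_powr' tendsto_intros) auto
    qed
    have meas: "(\<lambda>x. \<bar>s n x - u x\<bar> powr q) \<in> borel_measurable M" by measurable
    note F = Fatou_real[OF Lq_space_integrable[OF Lq_space_diff[OF q s s]] _ li meas ev]
    show ?thesis using F by (simp add: Lq_norm_le_iff[OF q0])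
  qed
  have "(\<lambda>x. s (N 0) x - u x) \<in> Lq_space M q"
    using est[of 0 "N 0"] by (simp add: Lq_space_def)
  from Lq_space_diff[OF q s[of "N 0"] this] have u: "u \<in> Lq_space M q" by simp
  have "(\<lambda>n. Lq_norm M q (\<lambda>x. s n x - u x)) \<longlonglongrightarrow> 0"
  proof (rule LIMSEQ_I)
    fix e :: real assume "e > 0"
    then obtain k where k: "(1/4) ^ k < e" using real_arch_pow_inv[of e "1/4"] by auto
    have "norm (Lq_norm M q (\<lambda>x. s n x - u x) - 0) < e" if "n \<ge> N k" for n
      using est[OF that] k Lq_norm_nonneg[of M q "\<lambda>x. s n x - u x"] by simp
    then show "\<exists>no. \<forall>n\<ge>no. norm (Lq_norm M q (\<lambda>x. s n x - u x) - 0) < e" by blast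
  qed
  then show ?thesis using that u r lim by blast
qed

section \<open>Semi-inner products and the Riesz representation\<close>

text \<open>
  Definiteness is left out, since a form on functions can only be definite modulo equality
  almost everywhere, and the energy alone need not be definite even then.
\<close>

locale semi_inner =
  fixes S :: "('a \<Rightarrow> real) set"
    and B :: "('a \<Rightarrow> real) \<Rightarrow> ('a \<Rightarrow> real) \<Rightarrow> real"
  assumes zero_mem: "(\<lambda>x. 0) \<in> S"
    and add_mem: "u \<in> S \<Longrightarrow> v \<in> S \<Longrightarrow> (\<lambda>x. u x + v x) \<in> S"
    and scale_mem: "u \<in> S \<Longrightarrow> (\<lambda>x. c * u x) \<in> S"
    and sym: "u \<in> S \<Longrightarrow> v \<in> S \<Longrightarrow> B u v = B v u"
    and add_left: "u \<in> S \<Longrightarrow> v \<in> S \<Longrightarrow> w \<in> S \<Longrightarrow> B (\<lambda>x. u x + v x) w = B u w + B v w"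
    and scale_left: "u \<in> S \<Longrightarrow> v \<in> S \<Longrightarrow> B (\<lambda>x. c * u x) v = c * B u v"
    and nonneg: "u \<in> S \<Longrightarrow> 0 \<le> B u u"
begin

lemma diff_mem: "u \<in> S \<Longrightarrow> v \<in> S \<Longrightarrow> (\<lambda>x. u x - v x) \<in> S"
  using add_mem[of u "\<lambda>x. -1 * v x"] scale_mem[of v "-1"] by simp

lemma diff_left: "u \<in> S \<Longrightarrow> v \<in> S \<Longrightarrow> w \<in> S \<Longrightarrow> B (\<lambda>x. u x - v x) w = B u w - B v w"
  using add_left[of u "\<lambda>x. -1 * v x" w] scale_left[of v w "-1"] scale_mem[of v "-1"] by simp

lemma add_right: "u \<in> S \<Longrightarrow> v \<in> S \<Longrightarrow> w \<in> S \<Longrightarrow> B w (\<lambda>x. u x + v x) = B w u + B w v"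
  using add_left[of u v w] sym[of w u] sym[of w v] sym[of w "\<lambda>x. u x + v x"] add_mem[of u v] by simp

lemma diff_right: "u \<in> S \<Longrightarrow> v \<in> S \<Longrightarrow> w \<in> S \<Longrightarrow> B w (\<lambda>x. u x - v x) = B w u - B w v"
  using diff_left[of u v w] sym[of w u] sym[of w v] sym[of w "\<lambda>x. u x - v x"] diff_mem[of u v] by simp

lemma scale_right: "u \<in> S \<Longrightarrow> v \<in> S \<Longrightarrow> B v (\<lambda>x. c * u x) = c * B v u"
  using scale_left[of u v c] sym[of v u] sym[of v "\<lambda>x. c * u x"] scale_mem[of u c] by simp

lemmas expand = add_left diff_left add_right diff_right scale_left scale_right
  add_mem diff_mem scale_mem

lemma zero_left: "u \<in> S \<Longrightarrow> B (\<lambda>x. 0) u = 0"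
  using scale_left[of u u 0] by simp

lemma square_scale: "u \<in> S \<Longrightarrow> B (\<lambda>x. c * u x) (\<lambda>x. c * u x) = c\<^sup>2 * B u u"
  by (simp add: expand power2_eq_square)

lemma square_add:
  "u \<in> S \<Longrightarrow> v \<in> S \<Longrightarrow>
    B (\<lambda>x. u x + v x) (\<lambda>x. u x + v x) = B u u + 2 * B u v + B v v"
  using sym[of u v] by (simp add: expand)

lemma square_diff:
  "u \<in> S \<Longrightarrow> v \<in> S \<Longrightarrow>
    B (\<lambda>x. u x - v x) (\<lambda>x. u x - v x) = B u u - 2 * B u v + B v v"
  using sym[of u v] by (simp add: expand)

lemma square_diff_commute:
  "u \<in> S \<Longrightarrow> v \<in> S \<Longrightarrow>
    B (\<lambda>x. u x - v x) (\<lambda>x. u x - v x) = B (\<lambda>x. v x - u x) (\<lambda>x. v x - u x)"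
  using sym[of u v] by (simp add: square_diff)

lemma square_diff_le:
  assumes "u \<in> S" "v \<in> S"
  shows "B (\<lambda>x. u x - v x) (\<lambda>x. u x - v x) \<le> 2 * B u u + 2 * B v v"
  using nonneg[OF add_mem[OF assms]] by (simp add: square_add square_diff assms)

lemma cauchy_schwarz:
  assumes u: "u \<in> S" and v: "v \<in> S"
  shows "\<bar>B u v\<bar> \<le> sqrt (B u u) * sqrt (B v v)"
proof -
  have quad: "0 \<le> B u u + 2 * t * B u v + t\<^sup>2 * B v v" for t
    using nonneg[OF add_mem[OF u scale_mem[OF v, of t]]] u v sym[OF u v]
    by (simp add: expand power2_eq_square algebra_simps)
  have "(B u v)\<^sup>2 \<le> B u u * B v v"
  proof (cases "B v v = 0")
    case True
    have "B u v = 0"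
    proof (rule ccontr)
      assume ne: "B u v \<noteq> 0"
      show False
        using quad[of "- (B u u + 1) / B u v"] ne True nonneg[OF u] by simp
    qed
    then show ?thesis using nonneg u v by simp
  next
    case False
    then have pos: "B v v > 0" using nonneg[OF v] by simp
    have "0 \<le> (B u u + 2 * (- B u v / B v v) * B u v + (- B u v / B v v)\<^sup>2 * B v v) * B v v"
      using quad[of "- B u v / B v v"] pos by (intro mult_nonneg_nonneg) auto
    also have "\<dots> = B u u * B v v - (B u v)\<^sup>2"
      using pos by (simp add: field_simps power2_eq_square)
    finally show ?thesis by simp
  qed
  then have "sqrt ((B u v)\<^sup>2) \<le> sqrt (B u u * B v v)" by (rule real_sqrt_le_mono)
  then show ?thesis by (simp add: real_sqrt_mult)
qed

lemma norm_triangle: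
  assumes u: "u \<in> S" and v: "v \<in> S"
  shows "sqrt (B (\<lambda>x. u x + v x) (\<lambda>x. u x + v x)) \<le> sqrt (B u u) + sqrt (B v v)"
proof (rule real_le_lsqrt)
  have "B u v \<le> sqrt (B u u) * sqrt (B v v)" using cauchy_schwarz[OF u v] by simp
  then show "B (\<lambda>x. u x + v x) (\<lambda>x. u x + v x) \<le> (sqrt (B u u) + sqrt (B v v))\<^sup>2"
    using nonneg u v by (simp add: square_add power2_sum)
qed (use nonneg u v in auto)

lemma norm_reverse_triangle:
  assumes u: "u \<in> S" and v: "v \<in> S"
  shows "\<bar>sqrt (B u u) - sqrt (B v v)\<bar> \<le> sqrt (B (\<lambda>x. u x - v x) (\<lambda>x. u x - v x))"
  using norm_triangle[OF diff_mem[OF u v] v] norm_triangle[OF diff_mem[OF v u] u]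
    square_diff_commute[OF u v] by simp

lemma tendsto_left:
  assumes s: "\<And>n. s n \<in> S" and u: "u \<in> S" and v: "v \<in> S"
    and lim: "(\<lambda>n. B (\<lambda>x. s n x - u x) (\<lambda>x. s n x - u x)) \<longlonglongrightarrow> 0"
  shows "(\<lambda>n. B (s n) v) \<longlonglongrightarrow> B u v"
proof -
  have "(\<lambda>n. sqrt (B (\<lambda>x. s n x - u x) (\<lambda>x. s n x - u x)) * sqrt (B v v)) \<longlonglongrightarrow> sqrt 0 * sqrt (B v v)"
    by (intro tendsto_intros lim)
  then have 0: "(\<lambda>n. sqrt (B (\<lambda>x. s n x - u x) (\<lambda>x. s n x - u x)) * sqrt (B v v)) \<longlonglongrightarrow> 0"
    by simp
  have "norm (B (s n) v - B u v) \<le> sqrt (B (\<lambda>x. s n x - u x) (\<lambda>x. s n x - u x)) * sqrt (B v v)" for n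
    using cauchy_schwarz[OF diff_mem[OF s u] v, of n] s u v by (simp add: diff_left)
  then have "(\<lambda>n. B (s n) v - B u v) \<longlonglongrightarrow> 0"
    by (intro Lim_null_comparison[OF _ 0] always_eventually allI)
  then show ?thesis by (simp add: LIM_zero_iff)
qed

definition complete :: bool where
  "complete \<longleftrightarrow> (\<forall>s. (\<forall>n. s n \<in> S) \<longrightarrow>
     (\<forall>e>0. \<exists>N. \<forall>m\<ge>N. \<forall>n\<ge>N. B (\<lambda>x. s m x - s n x) (\<lambda>x. s m x - s n x) < e) \<longrightarrow>
     (\<exists>u\<in>S. (\<lambda>n. B (\<lambda>x. s n x - u x) (\<lambda>x. s n x - u x)) \<longlonglongrightarrow> 0))"

text \<open>
  The functional is represented by the minimiser of \<open>B v v - 2 * l v\<close>. By the parallelogram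
  identity a minimising sequence is Cauchy, and its limit satisfies the Euler equation.
\<close>

lemma riesz:
  assumes complete: complete
    and l_add: "\<And>u v. u \<in> S \<Longrightarrow> v \<in> S \<Longrightarrow> l (\<lambda>x. u x + v x) = l u + l v"
    and l_scale: "\<And>u c. u \<in> S \<Longrightarrow> l (\<lambda>x. c * u x) = c * l u"
    and l_bound: "\<And>u. u \<in> S \<Longrightarrow> \<bar>l u\<bar> \<le> C * sqrt (B u u)"
  shows "\<exists>p\<in>S. \<forall>v\<in>S. B p v = l v"
proof -
  define J where "J u = B u u - 2 * l u" for u
  have J_ge: "- C\<^sup>2 \<le> J u" if "u \<in> S" for u
  proof -
    have "0 \<le> (sqrt (B u u) - C)\<^sup>2" by simp
    also have "\<dots> = B u u - 2 * (C * sqrt (B u u)) + C\<^sup>2"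
      using nonneg[OF that] by (simp add: power2_diff)
    finally show ?thesis using l_bound[OF that] by (simp add: J_def)
  qed
  define m where "m = (INF u\<in>S. J u)"
  have bdd: "bdd_below (J ` S)" using J_ge by (intro bdd_belowI2)
  have m_le: "m \<le> J u" if "u \<in> S" for u
    unfolding m_def by (rule cINF_lower[OF bdd that])
  have "\<exists>u\<in>S. J u < m + 1 / Suc n" for n
    using cINF_less_iff[of S J "m + 1 / Suc n"] bdd zero_mem by (auto simp: m_def)
  then obtain s where s: "\<And>n. s n \<in> S" "\<And>n. J (s n) < m + 1 / Suc n" by metis
  have par: "B (\<lambda>x. u x - v x) (\<lambda>x. u x - v x) = 2 * J u + 2 * J v - 4 * J (\<lambda>x. 1/2 * (u x + v x))"
    if "u \<in> S" "v \<in> S" for u v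
  proof -
    have "J (\<lambda>x. 1/2 * (u x + v x)) = 1/4 * (B u u + 2 * B u v + B v v) - (l u + l v)"
      unfolding J_def by (simp only: square_scale l_scale square_add l_add add_mem that)
        (simp add: power2_eq_square field_simps)
    then show ?thesis
      by (simp only: square_diff that) (simp add: J_def algebra_simps)
  qed
  have close: "B (\<lambda>x. s i x - s j x) (\<lambda>x. s i x - s j x) \<le> 2 / Suc i + 2 / Suc j" for i j
    using par[OF s(1) s(1), of i j] s(2)[of i] s(2)[of j]
      m_le[OF scale_mem[OF add_mem[OF s(1) s(1)], of "1/2" i j]] by simp
  have "\<exists>N. \<forall>i\<ge>N. \<forall>j\<ge>N. B (\<lambda>x. s i x - s j x) (\<lambda>x. s i x - s j x) < e" if "e > 0" for e
  proof -
    obtain N where N: "1 / Suc N < e / 4" using nat_approx_posE[of "e/4"] \<open>e > 0\<close> by auto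
    have "B (\<lambda>x. s i x - s j x) (\<lambda>x. s i x - s j x) < e" if "i \<ge> N" "j \<ge> N" for i j
    proof -
      have "1 / Suc i \<le> 1 / Suc N" "1 / Suc j \<le> 1 / Suc N"
        using that by (auto intro!: divide_left_mono)
      then show ?thesis using close[of i j] N by simp
    qed
    then show ?thesis by blast
  qed
  with complete s(1) obtain p where p: "p \<in> S"
      "(\<lambda>n. B (\<lambda>x. s n x - p x) (\<lambda>x. s n x - p x)) \<longlonglongrightarrow> 0"
    unfolding complete_def by blast
  have "B p v = l v" if v: "v \<in> S" for v
  proof -
    have quad: "0 \<le> t\<^sup>2 * B v v + 2 * t * (B p v - l v)" for t
    proof (rule LIMSEQ_le)
      show "(\<lambda>n. t\<^sup>2 * B v v + 2 * t * (B (s n) v - l v)) \<longlonglongrightarrow> t\<^sup>2 * B v v + 2 * t * (B p v - l v)"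
        by (intro tendsto_intros tendsto_left[OF s(1) p(1) v p(2)])
      show "(\<lambda>n. - 1 / Suc n) \<longlonglongrightarrow> (0::real)"
        using tendsto_minus[OF LIMSEQ_inverse_real_of_nat] by (simp add: inverse_eq_divide)
      have "- 1 / Suc n \<le> t\<^sup>2 * B v v + 2 * t * (B (s n) v - l v)" for n
      proof -
        have "J (\<lambda>x. s n x + t * v x) = J (s n) + t\<^sup>2 * B v v + 2 * t * (B (s n) v - l v)"
          using s(1)[of n] v scale_mem[OF v, of t]
          by (simp add: J_def square_add square_scale scale_right l_add l_scale algebra_simps)
        then show ?thesis
          using m_le[OF add_mem[OF s(1) scale_mem[OF v]], of n t] s(2)[of n] by simp
      qed
      then show "\<exists>N. \<forall>n\<ge>N. - 1 / Suc n \<le> t\<^sup>2 * B v v + 2 * t * (B (s n) v - l v)" by blast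
    qed
    define a b where "a = B v v" and "b = B p v - l v"
    have a: "a \<ge> 0" using nonneg[OF v] by (simp add: a_def)
    \<comment> \<open>Near its minimum the quadratic is negative unless \<open>b = 0\<close>; \<open>a + 1\<close> replaces \<open>a\<close>, which may be 0.\<close>
    define t where "t = - b / (a + 1)"
    have t: "t * (a + 1) = - b" using a by (simp add: t_def)
    have "0 \<le> (t\<^sup>2 * a + 2 * t * b) * (a + 1)\<^sup>2"
      using quad[of t] by (intro mult_nonneg_nonneg) (auto simp: a_def b_def)
    also have "\<dots> = (t * (a + 1))\<^sup>2 * a + 2 * (t * (a + 1)) * b * (a + 1)"
      by (simp add: algebra_simps power2_eq_square)
    also have "\<dots> = - (b\<^sup>2 * (a + 2))"
      unfolding t by (simp add: algebra_simps power2_eq_square)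
    finally have "b\<^sup>2 * (a + 2) \<le> 0" by simp
    then have "b\<^sup>2 \<le> 0" using a by (simp add: mult_le_0_iff)
    then show ?thesis by (simp add: b_def)
  qed
  with p(1) show ?thesis by blast
qed

end

lemma L2_integrable_mult:
  assumes u: "u \<in> Lq_space M 2" and v: "v \<in> Lq_space M 2"
  shows "integrable M (\<lambda>x. u x * v x)"
proof (rule Bochner_Integration.integrable_bound)
  show "integrable M (\<lambda>x. \<bar>u x\<bar> powr 2 + \<bar>v x\<bar> powr 2)"
    using u v by (auto simp: Lq_space_def)
  show "(\<lambda>x. u x * v x) \<in> borel_measurable M"
    using u v by (auto simp: Lq_space_def)
  have "\<bar>a * b\<bar> \<le> a\<^sup>2 + b\<^sup>2" for a b :: real
    using sum_squares_bound[of "\<bar>a\<bar>" "\<bar>b\<bar>"] abs_ge_zero[of "a * b"]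
    unfolding abs_mult power2_abs by linarith
  then show "AE x in M. norm (u x * v x) \<le> norm (\<bar>u x\<bar> powr 2 + \<bar>v x\<bar> powr 2)"
    by (intro AE_I2) simp
qed

lemma L2_semi_inner: "semi_inner (Lq_space M 2) (\<lambda>u v. \<integral>x. u x * v x \<partial>M)"
proof
  fix u v w :: "'a \<Rightarrow> real" and c :: real
  show "(\<lambda>x. 0) \<in> Lq_space M 2" by (rule Lq_space_zero) simp
  assume u: "u \<in> Lq_space M 2"
  show "(\<lambda>x. c * u x) \<in> Lq_space M 2" by (rule Lq_space_scale[OF u])
  show "0 \<le> (\<integral>x. u x * u x \<partial>M)" by (intro integral_nonneg_AE) simp
  show "(\<integral>x. c * u x * v x \<partial>M) = c * (\<integral>x. u x * v x \<partial>M)"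
    by (simp add: mult.assoc)
  show "(\<integral>x. u x * v x \<partial>M) = (\<integral>x. v x * u x \<partial>M)" by (simp add: mult.commute)
  assume v: "v \<in> Lq_space M 2"
  show "(\<lambda>x. u x + v x) \<in> Lq_space M 2" by (rule Lq_space_add[OF _ u v]) simp
  assume w: "w \<in> Lq_space M 2"
  show "(\<integral>x. (u x + v x) * w x \<partial>M) = (\<integral>x. u x * w x \<partial>M) + (\<integral>x. v x * w x \<partial>M)"
    using L2_integrable_mult[OF u w] L2_integrable_mult[OF v w] by (simp add: distrib_right)
qed

section \<open>Truncation and resolvents in a Dirichlet form\<close>

definition trunc :: "real \<Rightarrow> ('a \<Rightarrow> real) \<Rightarrow> 'a \<Rightarrow> real" where
  "trunc c u = (\<lambda>x. min (max (u x) 0) c)"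

context dirichlet_form
begin

sublocale energy: semi_inner F E
  by unfold_locales
     (use dom_zero dom_add dom_scale form_sym form_add form_scale form_nonneg in auto)

definition E1 :: "('a \<Rightarrow> real) \<Rightarrow> ('a \<Rightarrow> real) \<Rightarrow> real" where
  "E1 u v = (\<integral>x. u x * v x \<partial>M) + E u v"

lemma dom_Lq: "u \<in> F \<Longrightarrow> u \<in> Lq_space M 2"
  using dom_L2 by blast

lemma dom_measurable: "u \<in> F \<Longrightarrow> u \<in> borel_measurable M"
  using dom_Lq Lq_space_measurable by blast

lemma energy_ae:
  assumes "u \<in> F" "v \<in> F" "AE x in M. u x = v x"
  shows "E u u = E v v"
  using form_ae[OF assms assms(1)] form_ae[OF assms assms(2)] form_sym[OF assms(1,2)] by simp

sublocale energy1: semi_inner F E1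
proof -
  interpret L2: semi_inner "Lq_space M 2" "\<lambda>u v. \<integral>x. u x * v x \<partial>M" by (rule L2_semi_inner)
  show "semi_inner F E1"
  proof
    fix u v w c
    show "(\<lambda>x. 0) \<in> F" by (rule dom_zero)
    assume u: "u \<in> F"
    show "(\<lambda>x. c * u x) \<in> F" by (rule dom_scale[OF u])
    show "0 \<le> E1 u u" using L2.nonneg[OF dom_Lq[OF u]] form_nonneg[OF u] by (simp add: E1_def)
    assume v: "v \<in> F"
    show "(\<lambda>x. u x + v x) \<in> F" by (rule dom_add[OF u v])
    show "E1 u v = E1 v u"
      unfolding E1_def using L2.sym[OF dom_Lq[OF u] dom_Lq[OF v]] form_sym[OF u v] by (rule arg_cong2)
    show "E1 (\<lambda>x. c * u x) v = c * E1 u v"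
      using L2.scale_left[OF dom_Lq[OF u] dom_Lq[OF v], of c] form_scale[OF u v, of c]
      unfolding E1_def by (simp only: distrib_left)
    assume w: "w \<in> F"
    show "E1 (\<lambda>x. u x + v x) w = E1 u w + E1 v w"
      using L2.add_left[OF dom_Lq[OF u] dom_Lq[OF v] dom_Lq[OF w]] form_add[OF u v w]
      unfolding E1_def by linarith
  qed
qed

lemma E_le_E1: "u \<in> F \<Longrightarrow> E u u \<le> E1 u u"
  unfolding E1_def using integral_nonneg_AE[of "\<lambda>x. u x * u x" M] by simp

lemma L2_le_E1: "u \<in> F \<Longrightarrow> (\<integral>x. u x * u x \<partial>M) \<le> E1 u u"
  unfolding E1_def using form_nonneg[of u] by simp

lemma energy1_complete: "energy1.complete"
proof -
  interpret ae_function_space M F "\<lambda>u. sqrt ((\<integral>x. u x * u x \<partial>M) + E u u)"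
  proof
    fix u v assume uv: "u \<in> F" "v \<in> F" "AE x in M. u x = v x"
    have "(\<integral>x. u x * u x \<partial>M) = (\<integral>x. v x * v x \<partial>M)"
    proof (rule integral_cong_AE)
      show "AE x in M. u x * u x = v x * v x" using uv(3) by eventually_elim simp
    qed (use uv dom_measurable in auto)
    with energy_ae[OF uv]
    show "sqrt ((\<integral>x. u x * u x \<partial>M) + E u u) = sqrt ((\<integral>x. v x * v x \<partial>M) + E v v)" by simp
  qed (fact dom_measurable dom_ae dom_zero dom_add dom_scale)+
  show ?thesis
    unfolding energy1.complete_def
  proof (intro allI impI)
    fix s :: "nat \<Rightarrow> 'a \<Rightarrow> real"
    assume s: "\<forall>n. s n \<in> F"
      and cau: "\<forall>e>0. \<exists>N. \<forall>m\<ge>N. \<forall>n\<ge>N. E1 (\<lambda>x. s m x - s n x) (\<lambda>x. s m x - s n x) < e"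
    have "\<exists>u\<in>F. (\<lambda>n. sqrt (E1 (\<lambda>x. s n x - u x) (\<lambda>x. s n x - u x))) \<longlonglongrightarrow> 0"
      unfolding E1_def
    proof (rule completeD[OF hilbert])
      fix e :: real assume e: "e > 0"
      then obtain N where N: "\<forall>m\<ge>N. \<forall>n\<ge>N. E1 (\<lambda>x. s m x - s n x) (\<lambda>x. s m x - s n x) < e\<^sup>2"
        using cau[rule_format, of "e\<^sup>2"] by auto
      have "sqrt (E1 (\<lambda>x. s m x - s n x) (\<lambda>x. s m x - s n x)) < e" if "m \<ge> N" "n \<ge> N" for m n
        using N that e by (intro real_less_lsqrt) auto
      then show "\<exists>k. \<forall>m\<ge>k. \<forall>n\<ge>k. sqrt ((\<integral>x. (s m x - s n x) * (s m x - s n x) \<partial>M) +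
          E (\<lambda>x. s m x - s n x) (\<lambda>x. s m x - s n x)) < e"
        unfolding E1_def by blast
    qed (use s in blast)
    then obtain u where u: "u \<in> F" "(\<lambda>n. sqrt (E1 (\<lambda>x. s n x - u x) (\<lambda>x. s n x - u x))) \<longlonglongrightarrow> 0"
      by blast
    have "(\<lambda>n. (sqrt (E1 (\<lambda>x. s n x - u x) (\<lambda>x. s n x - u x)))\<^sup>2) \<longlonglongrightarrow> 0\<^sup>2"
      by (intro tendsto_power u(2))
    then have "(\<lambda>n. E1 (\<lambda>x. s n x - u x) (\<lambda>x. s n x - u x)) \<longlonglongrightarrow> 0"
      using s u(1) energy1.nonneg energy1.diff_mem by simp
    with u(1) show "\<exists>u\<in>F. (\<lambda>n. E1 (\<lambda>x. s n x - u x) (\<lambda>x. s n x - u x)) \<longlonglongrightarrow> 0" by blast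
  qed
qed

lemma trunc_eq_unit_trunc:
  assumes "c > 0"
  shows "trunc c u = (\<lambda>x. c * min (max (1 / c * u x) 0) 1)"
  using assms by (auto simp: trunc_def min_def max_def field_simps)

lemma trunc_mem: "c > 0 \<Longrightarrow> u \<in> F \<Longrightarrow> trunc c u \<in> F"
  unfolding trunc_eq_unit_trunc by (intro dom_scale markov_dom)

lemma trunc_energy:
  assumes c: "c > 0" and u: "u \<in> F"
  shows "E (trunc c u) (trunc c u) \<le> E u u"
proof -
  have "E (trunc c u) (trunc c u) =
      c\<^sup>2 * E (\<lambda>x. min (max (1 / c * u x) 0) 1) (\<lambda>x. min (max (1 / c * u x) 0) 1)"
    unfolding trunc_eq_unit_trunc[OF c] by (rule energy.square_scale[OF markov_dom[OF dom_scale[OF u]]])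
  also have "\<dots> \<le> c\<^sup>2 * E (\<lambda>x. 1 / c * u x) (\<lambda>x. 1 / c * u x)"
    by (intro mult_left_mono markov_form dom_scale u) simp
  also have "\<dots> = c\<^sup>2 * ((1 / c)\<^sup>2 * E u u)"
    by (simp only: energy.square_scale[OF u])
  also have "\<dots> = E u u" using c by (simp add: power_divide)
  finally show ?thesis .
qed

text \<open>
  Moving from the truncation towards \<open>u\<close> does not change the truncation. By the Markov property
  the energy is therefore smallest at the starting point of this segment, so its derivative
  \<open>2 * E (trunc c u) (u - trunc c u)\<close> there is non-negative. Adding
  \<open>E (trunc c u) (trunc c u)\<close> to half of it gives the claim.
\<close>

lemma trunc_cross_nonneg:
  assumes c: "c > 0" and u: "u \<in> F"
  shows "0 \<le> E (trunc c u) u"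
proof -
  let ?T = "trunc c u" and ?R = "\<lambda>x. u x - trunc c u x"
  have T: "?T \<in> F" by (rule trunc_mem[OF c u])
  have R: "?R \<in> F" by (rule energy.diff_mem[OF u T])
  have quad: "0 \<le> 2 * E ?T ?R + t * E ?R ?R" if t: "0 < t" "t \<le> 1" for t
  proof -
    have eq: "trunc c (\<lambda>x. ?T x + t * ?R x) = ?T"
    proof
      fix x
      consider "u x < 0" | "0 \<le> u x" "u x \<le> c" | "c < u x" by linarith
      then show "trunc c (\<lambda>x. ?T x + t * ?R x) x = ?T x"
      proof cases
        case 1
        then have "t * u x \<le> 0" using t by (simp add: mult_nonneg_nonpos)
        then show ?thesis using 1 c by (simp add: trunc_def)
      next
        case 2 then show ?thesis using c by (simp add: trunc_def)
      next
        case 3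
        then have "t * (u x - c) \<ge> 0" using t by simp
        then show ?thesis using 3 c by (simp add: trunc_def)
      qed
    qed
    have "E ?T ?T \<le> E (\<lambda>x. ?T x + t * ?R x) (\<lambda>x. ?T x + t * ?R x)"
      using trunc_energy[OF c dom_add[OF T dom_scale[OF R, of t]]] unfolding eq .
    also have "\<dots> = E ?T ?T + 2 * (t * E ?T ?R) + t\<^sup>2 * E ?R ?R"
      by (simp only: energy.square_add[OF T dom_scale[OF R]] energy.scale_right[OF R T] energy.square_scale[OF R])
    finally have "0 \<le> t * (2 * E ?T ?R + t * E ?R ?R)"
      by (simp add: power2_eq_square algebra_simps)
    then show ?thesis using t by (simp add: zero_le_mult_iff)
  qed
  have "0 \<le> 2 * E ?T ?R"
  proof (rule LIMSEQ_le_const)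
    have "(\<lambda>n. 2 * E ?T ?R + 1 / Suc n * E ?R ?R) \<longlonglongrightarrow> 2 * E ?T ?R + 0 * E ?R ?R"
      using LIMSEQ_inverse_real_of_nat by (intro tendsto_intros) (simp add: inverse_eq_divide)
    then show "(\<lambda>n. 2 * E ?T ?R + 1 / Suc n * E ?R ?R) \<longlonglongrightarrow> 2 * E ?T ?R" by simp
    show "\<exists>N. \<forall>n\<ge>N. 0 \<le> 2 * E ?T ?R + 1 / Suc n * E ?R ?R"
      using quad[of "1 / Suc n" for n] by simp
  qed
  moreover have "E ?T ?R = E ?T u - E ?T ?T" by (rule energy.diff_right[OF u T T])
  ultimately show ?thesis using form_nonneg[OF T] by simp
qed

text \<open>
  The function \<open>g\<close> is the resolvent of \<open>f\<close> at 1, the Riesz representative of \<open>v \<mapsto> \<integral> f v\<close> in the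
  Hilbert space given by the domain.
\<close>

lemma resolvent_exists:
  assumes f: "f \<in> Lq_space M 2"
  obtains g where "g \<in> F" "\<And>v. v \<in> F \<Longrightarrow> E1 g v = (\<integral>x. f x * v x \<partial>M)"
proof -
  interpret L2: semi_inner "Lq_space M 2" "\<lambda>u v. \<integral>x. u x * v x \<partial>M" by (rule L2_semi_inner)
  have "\<exists>g\<in>F. \<forall>v\<in>F. E1 g v = (\<integral>x. f x * v x \<partial>M)"
  proof (rule energy1.riesz[OF energy1_complete])
    fix u v c assume u: "u \<in> F"
    note uL = dom_Lq[OF u]
    show "(\<integral>x. f x * (c * u x) \<partial>M) = c * (\<integral>x. f x * u x \<partial>M)"
      by (rule L2.scale_right[OF uL f])
    have "\<bar>\<integral>x. f x * u x \<partial>M\<bar> \<le> sqrt (\<integral>x. f x * f x \<partial>M) * sqrt (\<integral>x. u x * u x \<partial>M)"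
      by (rule L2.cauchy_schwarz[OF f uL])
    also have "\<dots> \<le> sqrt (\<integral>x. f x * f x \<partial>M) * sqrt (E1 u u)"
      using L2.nonneg[OF f] by (intro mult_left_mono real_sqrt_le_mono L2_le_E1 u) simp
    finally show "\<bar>\<integral>x. f x * u x \<partial>M\<bar> \<le> sqrt (\<integral>x. f x * f x \<partial>M) * sqrt (E1 u u)" .
    assume "v \<in> F"
    then show "(\<integral>x. f x * (u x + v x) \<partial>M) = (\<integral>x. f x * u x \<partial>M) + (\<integral>x. f x * v x \<partial>M)"
      by (intro L2.add_right uL f dom_Lq)
  qed
  then show ?thesis using that by blast
qed

text \<open>
  Test the equation of the resolvent with \<open>v = trunc 1 (n * g)\<close>. The energy term is
  non-negative, hence \<open>\<integral> g v \<le> \<integral> f v \<le> \<integral> \<bar>f\<bar>\<close>, and \<open>g v\<close> increases to the positive part of \<open>g\<close>.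
\<close>

lemma resolvent_positive_part_integrable:
  assumes f: "f \<in> Lq_space M 2" "integrable M f"
    and g: "g \<in> F" and res: "\<And>v. v \<in> F \<Longrightarrow> E1 g v = (\<integral>x. f x * v x \<partial>M)"
  shows "integrable M (\<lambda>x. max (g x) 0)"
proof -
  define v where "v n = trunc 1 (\<lambda>x. real (Suc n) * g x)" for n
  have v: "v n \<in> F" for n unfolding v_def by (intro trunc_mem dom_scale g) simp
  have v01: "0 \<le> v n x" "v n x \<le> 1" for n x by (auto simp: v_def trunc_def)
  have gv: "integrable M (\<lambda>x. g x * v n x)" for n
    by (rule L2_integrable_mult[OF dom_Lq[OF g] dom_Lq[OF v]])
  have le: "(\<integral>x. g x * v n x \<partial>M) \<le> (\<integral>x. \<bar>f x\<bar> \<partial>M)" for n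
  proof -
    have "0 \<le> E (v n) (\<lambda>x. real (Suc n) * g x)"
      unfolding v_def by (intro trunc_cross_nonneg dom_scale g) simp
    also have "\<dots> = real (Suc n) * E (v n) g" by (rule energy.scale_right[OF g v])
    finally have "0 \<le> E (v n) g" by (simp add: zero_le_mult_iff)
    then have "(\<integral>x. g x * v n x \<partial>M) \<le> E1 g (v n)"
      using form_sym[OF g v[of n]] by (simp add: E1_def)
    also have "\<dots> = (\<integral>x. f x * v n x \<partial>M)" by (rule res[OF v])
    also have "\<dots> \<le> (\<integral>x. \<bar>f x\<bar> \<partial>M)"
    proof (rule integral_mono[OF L2_integrable_mult[OF f(1) dom_Lq[OF v]] integrable_abs[OF f(2)]])
      fix x
      have "f x * v n x \<le> \<bar>f x\<bar> * v n x" by (rule mult_right_mono) (use v01 in auto)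
      also have "\<dots> \<le> \<bar>f x\<bar> * 1" by (rule mult_left_mono) (use v01 in auto)
      finally show "f x * v n x \<le> \<bar>f x\<bar>" by simp
    qed
    finally show ?thesis .
  qed
  have lim: "(\<lambda>n. g x * v n x) \<longlonglongrightarrow> max (g x) 0" for x
  proof (cases "g x > 0")
    case True
    obtain N :: nat where N: "1 / g x \<le> real N" using real_arch_simple by blast
    have "v n x = 1" if "n \<ge> N" for n
    proof -
      have "1 / g x \<le> real (Suc n)" using N that by linarith
      then have "1 \<le> real (Suc n) * g x" using True by (simp add: field_simps)
      then show ?thesis by (simp add: v_def trunc_def)
    qed
    then have "\<forall>\<^sub>F n in sequentially. max (g x) 0 = g x * v n x"
      using True by (intro eventually_sequentiallyI[of N]) simp
    then show ?thesis by (rule Lim_transform_eventually[OF tendsto_const])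
  next
    case False
    then have "real (Suc n) * g x \<le> 0" for n by (intro mult_nonneg_nonpos) auto
    then have "v n x = 0" for n by (simp add: v_def trunc_def max_absorb2 del: of_nat_Suc)
    then show ?thesis using False by simp
  qed
  have nn: "0 \<le> g x * v n x" for n x
    by (cases "0 \<le> g x") (auto simp: v_def trunc_def mult_nonneg_nonpos max_def min_def zero_le_mult_iff)
  show ?thesis
    using Fatou_real(1)[OF gv nn AE_I2[OF lim], of "\<integral>x. \<bar>f x\<bar> \<partial>M"] le dom_measurable[OF g]
    by simp
qed

text \<open>
  Apply the previous lemma to \<open>f\<close> and to \<open>- f\<close>. The resolvents of integrable functions are the
  test functions \<open>g\<close> for which \<open>E z g = \<integral> z h\<close> with an integrable \<open>h = f - g\<close>, so that bounded
  convergence of \<open>z\<close> is enough to pass to the limit.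
\<close>

lemma resolvent_integrable:
  assumes f: "f \<in> Lq_space M 2" "integrable M f"
    and g: "g \<in> F" and res: "\<And>v. v \<in> F \<Longrightarrow> E1 g v = (\<integral>x. f x * v x \<partial>M)"
  shows "integrable M g"
proof -
  have "integrable M (\<lambda>x. max ((-1) * g x) 0)"
  proof (rule resolvent_positive_part_integrable[OF Lq_space_scale[OF f(1), of "-1"]])
    show "E1 (\<lambda>x. (-1) * g x) v = (\<integral>x. (-1) * f x * v x \<partial>M)" if "v \<in> F" for v
      using energy1.scale_left[OF g that, of "-1"] res[OF that] by simp
  qed (use f g dom_scale[OF g, of "-1"] in auto)
  with resolvent_positive_part_integrable[OF f g res]
  have "integrable M (\<lambda>x. max (g x) 0 - max ((-1) * g x) 0)"
    by (rule Bochner_Integration.integrable_diff)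
  moreover have "max a 0 - max ((-1) * a) 0 = a" for a :: real by simp
  ultimately show ?thesis by simp
qed

section \<open>Closability under convergence almost everywhere\<close>

text \<open>
  No bound on the \<open>L\<^sup>2\<close> norms of the \<open>z k\<close> is available, so weak convergence in the domain cannot
  be obtained from weak compactness. Instead, the set \<open>N\<close> of all \<open>g\<close> with \<open>E (z k) g \<longlonglongrightarrow> 0\<close> is a
  closed subspace of the domain by the energy bound. It contains the resolvent \<open>g\<close> of every
  \<open>f\<close> in \<open>L\<^sup>1\<close> and \<open>L\<^sup>2\<close>, because \<open>E (z k) g = \<integral> z k (f - g)\<close>. A function orthogonal to these resolvents
  has zero integral against every such \<open>f\<close> and vanishes almost everywhere; hence \<open>N\<close> is the
  whole domain.
\<close>

lemma weakly_null_if_null_against_L1_L2: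
  assumes z: "\<And>k. z k \<in> F" and bound: "\<And>k. E (z k) (z k) \<le> C"
    and null: "\<And>h. h \<in> Lq_space M 2 \<Longrightarrow> integrable M h \<Longrightarrow> (\<lambda>k. \<integral>x. z k x * h x \<partial>M) \<longlonglongrightarrow> 0"
    and u: "u \<in> F"
  shows "(\<lambda>k. E (z k) u) \<longlonglongrightarrow> 0"
proof -
  interpret L2: semi_inner "Lq_space M 2" "\<lambda>u v. \<integral>x. u x * v x \<partial>M" by (rule L2_semi_inner)
  define N where "N = {g \<in> F. (\<lambda>k. E (z k) g) \<longlonglongrightarrow> 0}"
  have NF: "g \<in> N \<Longrightarrow> g \<in> F" for g by (simp add: N_def)
  interpret N: semi_inner N E1
  proof
    fix g h w c
    show "(\<lambda>x. 0) \<in> N"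
      using energy.zero_left[OF z] form_sym[OF dom_zero z] by (simp add: N_def dom_zero)
    assume g: "g \<in> N"
    then have "(\<lambda>k. c * E (z k) g) \<longlonglongrightarrow> c * 0" unfolding N_def by (intro tendsto_intros) auto
    then show "(\<lambda>x. c * g x) \<in> N"
      using energy.scale_right[OF NF[OF g] z] dom_scale[OF NF[OF g]] by (simp add: N_def)
    show "0 \<le> E1 g g" by (rule energy1.nonneg[OF NF[OF g]])
    show "E1 (\<lambda>x. c * g x) h = c * E1 g h" if "h \<in> N" for h
      by (rule energy1.scale_left[OF NF[OF g] NF[OF that]])
    assume h: "h \<in> N"
    have "(\<lambda>k. E (z k) g + E (z k) h) \<longlonglongrightarrow> 0 + 0"
      using g h unfolding N_def by (intro tendsto_intros) auto
    then show "(\<lambda>x. g x + h x) \<in> N"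
      using energy.add_right[OF NF[OF g] NF[OF h] z] dom_add[OF NF[OF g] NF[OF h]] by (simp add: N_def)
    show "E1 g h = E1 h g" by (rule energy1.sym[OF NF[OF g] NF[OF h]])
    assume w: "w \<in> N"
    show "E1 (\<lambda>x. g x + h x) w = E1 g w + E1 h w"
      by (rule energy1.add_left[OF NF[OF g] NF[OF h] NF[OF w]])
  qed
  have complete: "N.complete"
    unfolding N.complete_def
  proof (intro allI impI)
    fix s :: "nat \<Rightarrow> 'a \<Rightarrow> real"
    assume s: "\<forall>n. s n \<in> N"
      and cau: "\<forall>e>0. \<exists>N. \<forall>m\<ge>N. \<forall>n\<ge>N. E1 (\<lambda>x. s m x - s n x) (\<lambda>x. s m x - s n x) < e"
    have sF: "s n \<in> F" for n using s NF by blast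
    obtain p where p: "p \<in> F" "(\<lambda>n. E1 (\<lambda>x. s n x - p x) (\<lambda>x. s n x - p x)) \<longlonglongrightarrow> 0"
      using energy1_complete cau sF unfolding energy1.complete_def by blast
    have "(\<lambda>k. E (z k) p) \<longlonglongrightarrow> 0"
    proof (rule LIMSEQ_I)
      fix e :: real assume e: "e > 0"
      define C' where "C' = max C 1"
      have C': "C' > 0" "E (z k) (z k) \<le> C'" for k using bound[of k] by (auto simp: C'_def)
      have "\<forall>\<^sub>F n in sequentially. E1 (\<lambda>x. s n x - p x) (\<lambda>x. s n x - p x) < (e / 2)\<^sup>2 / C'"
        using order_tendstoD(2)[OF p(2)] e C' by simp
      then obtain n where n: "E1 (\<lambda>x. s n x - p x) (\<lambda>x. s n x - p x) < (e / 2)\<^sup>2 / C'"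
        by (auto simp: eventually_sequentially)
      have d: "(\<lambda>x. s n x - p x) \<in> F" by (rule energy.diff_mem[OF sF p(1)])
      have small: "\<bar>E (z k) (s n) - E (z k) p\<bar> < e / 2" for k
      proof -
        have "\<bar>E (z k) (s n) - E (z k) p\<bar> \<le>
            sqrt (E (z k) (z k)) * sqrt (E (\<lambda>x. s n x - p x) (\<lambda>x. s n x - p x))"
          using energy.cauchy_schwarz[OF z d, of k] energy.diff_right[OF sF p(1) z, of k n] by simp
        also have "\<dots> \<le> sqrt C' * sqrt (E1 (\<lambda>x. s n x - p x) (\<lambda>x. s n x - p x))"
          using C' form_nonneg[OF d]
          by (intro mult_mono real_sqrt_le_mono E_le_E1 d) auto
        also have "\<dots> < sqrt C' * sqrt ((e / 2)\<^sup>2 / C')"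
          using C' n by (intro mult_strict_left_mono real_sqrt_less_mono) auto
        also have "\<dots> = e / 2" using e C' by (simp add: real_sqrt_divide)
        finally show ?thesis .
      qed
      obtain K where K: "\<And>k. k \<ge> K \<Longrightarrow> \<bar>E (z k) (s n)\<bar> < e / 2"
        using s e LIMSEQ_D[of "\<lambda>k. E (z k) (s n)" 0 "e / 2"] by (auto simp: N_def)
      have "norm (E (z k) p - 0) < e" if "k \<ge> K" for k
        using small[of k] K[OF that] by (simp only: real_norm_def)
      then show "\<exists>no. \<forall>k\<ge>no. norm (E (z k) p - 0) < e" by blast
    qed
    with p show "\<exists>p\<in>N. (\<lambda>n. E1 (\<lambda>x. s n x - p x) (\<lambda>x. s n x - p x)) \<longlonglongrightarrow> 0"
      by (auto simp: N_def)
  qed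
  have "\<exists>p\<in>N. \<forall>v\<in>N. E1 p v = E1 u v"
  proof (rule N.riesz[OF complete])
    fix v w c assume v: "v \<in> N"
    show "E1 u (\<lambda>x. c * v x) = c * E1 u v" by (rule energy1.scale_right[OF NF[OF v] u])
    show "\<bar>E1 u v\<bar> \<le> sqrt (E1 u u) * sqrt (E1 v v)" by (rule energy1.cauchy_schwarz[OF u NF[OF v]])
    assume w: "w \<in> N"
    show "E1 u (\<lambda>x. v x + w x) = E1 u v + E1 u w"
      by (rule energy1.add_right[OF NF[OF v] NF[OF w] u])
  qed
  then obtain p where p: "p \<in> N" "\<And>v. v \<in> N \<Longrightarrow> E1 p v = E1 u v" by blast
  note pF = NF[OF p(1)]
  define d where "d x = u x - p x" for x
  have dF: "d \<in> F" unfolding d_def by (rule energy.diff_mem[OF u pF])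
  note dL = dom_Lq[OF dF]
  have [measurable]: "d \<in> borel_measurable M" by (rule dom_measurable[OF dF])
  have orth: "(\<integral>x. f x * d x \<partial>M) = 0" if f: "f \<in> Lq_space M 2" "integrable M f" for f
  proof -
    obtain g where g: "g \<in> F" "\<And>v. v \<in> F \<Longrightarrow> E1 g v = (\<integral>x. f x * v x \<partial>M)"
      using resolvent_exists[OF f(1)] by blast
    have gL: "g \<in> Lq_space M 2" by (rule dom_Lq[OF g(1)])
    have h: "(\<lambda>x. f x - g x) \<in> Lq_space M 2" "integrable M (\<lambda>x. f x - g x)"
      using Lq_space_diff[OF _ f(1) gL] resolvent_integrable[OF f g] f(2) by auto
    have "E (z k) g = (\<integral>x. z k x * (f x - g x) \<partial>M)" for k
    proof -
      have zL: "z k \<in> Lq_space M 2" by (rule dom_Lq[OF z])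
      have "E (z k) g = E1 g (z k) - (\<integral>x. g x * z k x \<partial>M)"
        unfolding E1_def using form_sym[OF z g(1)] by simp
      also have "\<dots> = (\<integral>x. f x * z k x \<partial>M) - (\<integral>x. g x * z k x \<partial>M)"
        by (simp only: g(2)[OF z])
      also have "\<dots> = (\<integral>x. (f x - g x) * z k x \<partial>M)"
        using L2.diff_left[OF f(1) gL zL] by simp
      finally show ?thesis by (simp add: mult.commute)
    qed
    then have "g \<in> N" using null[OF h] g(1) by (simp add: N_def)
    then have "E1 p g = E1 u g" by (rule p(2))
    then have "E1 d g = 0" unfolding d_def using energy1.diff_left[OF u pF g(1)] by simp
    then have "E1 g d = 0" using energy1.sym[OF dF g(1)] by simp
    then show ?thesis using g(2)[OF dF] by simp
  qed
  have small: "AE x in M. \<bar>d x\<bar> \<le> e" if e: "e > 0" for e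
  proof -
    \<comment> \<open>Cutting off the small values of \<open>d\<close> makes it integrable: \<open>\<bar>d\<bar> \<le> d\<^sup>2 / e\<close> where \<open>\<bar>d\<bar> > e\<close>.\<close>
    define f where "f x = (if \<bar>d x\<bar> > e then d x else 0)" for x
    have fm [measurable]: "f \<in> borel_measurable M" unfolding f_def by measurable
    have d2: "integrable M (\<lambda>x. d x * d x)" by (rule L2_integrable_mult[OF dL dL])
    have "\<bar>f x\<bar> \<le> d x * d x / e" for x
    proof (cases "\<bar>d x\<bar> > e")
      case True
      then have "\<bar>d x\<bar> * e \<le> \<bar>d x\<bar> * \<bar>d x\<bar>" by (intro mult_left_mono) auto
      then show ?thesis using True e by (simp add: f_def field_simps)
    qed (use e in \<open>simp add: f_def\<close>)
    then have fi: "integrable M f"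
      using e by (intro Bochner_Integration.integrable_bound[OF integrable_divide_zero[OF d2, of e]] AE_I2) auto
    have "integrable M (\<lambda>x. \<bar>f x\<bar> powr 2)"
      by (rule Bochner_Integration.integrable_bound[OF Lq_space_integrable[OF dL]])
         (auto simp: f_def)
    then have fL: "f \<in> Lq_space M 2" by (simp add: Lq_space_def)
    have "AE x in M. f x * d x = 0"
      using orth[OF fL fi] integral_nonneg_eq_0_iff_AE[OF L2_integrable_mult[OF fL dL]]
      by (auto simp: f_def)
    then show ?thesis by eventually_elim (use e in \<open>auto simp: f_def split: if_splits\<close>)
  qed
  have "AE x in M. \<forall>n. \<bar>d x\<bar> \<le> 1 / Suc n"
    by (subst AE_all_countable) (use small in simp)
  then have "AE x in M. u x = p x"
  proof eventually_elim
    case (elim x)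
    have "\<bar>d x\<bar> \<le> 0"
    proof (rule field_le_epsilon)
      fix e :: real assume "e > 0"
      then obtain n where "1 / Suc n < e" using nat_approx_posE by blast
      then show "\<bar>d x\<bar> \<le> 0 + e" using elim[rule_format, of n] by simp
    qed
    then show ?case by (simp add: d_def)
  qed
  then have "E (z k) u = E (z k) p" for k
    using form_ae[OF u pF _ z[of k]] form_sym[OF u z] form_sym[OF pF z] by simp
  then show ?thesis using p(1) by (simp add: N_def)
qed

text \<open>
  The differences \<open>trunc c (w k) - trunc c u\<close> are bounded by \<open>c\<close> and tend to 0 almost
  everywhere, so by dominated convergence they tend to 0 against integrable functions, and
  their energies are bounded. They are thus weakly null for \<open>E\<close>, and the norm is weakly lower
  semicontinuous.
\<close>

lemma trunc_energy_le_of_AE_limit: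
  assumes w: "\<And>k. w k \<in> F" and u: "u \<in> F" and lim: "AE x in M. (\<lambda>k. w k x) \<longlonglongrightarrow> u x"
    and bound: "\<And>k. E (w k) (w k) \<le> D" and c: "c > 0"
  shows "E (trunc c u) (trunc c u) \<le> D"
proof -
  let ?T = "trunc c"
  define z where "z k = (\<lambda>x. ?T (w k) x - ?T u x)" for k
  have Tw: "?T (w k) \<in> F" for k by (rule trunc_mem[OF c w])
  have Tu: "?T u \<in> F" by (rule trunc_mem[OF c u])
  have zF: "z k \<in> F" for k unfolding z_def by (rule energy.diff_mem[OF Tw Tu])
  have [measurable]: "z k \<in> borel_measurable M" for k by (rule dom_measurable[OF zF])
  have null: "(\<lambda>k. E (z k) (?T u)) \<longlonglongrightarrow> 0"
  proof (rule weakly_null_if_null_against_L1_L2[OF zF _ _ Tu])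
    show "E (z k) (z k) \<le> 2 * D + 2 * E u u" for k
      using energy.square_diff_le[OF Tw[of k] Tu] trunc_energy[OF c w[of k]] trunc_energy[OF c u] bound[of k]
      unfolding z_def by linarith
    fix h :: "'a \<Rightarrow> real"
    assume h: "integrable M h"
    note [measurable] = borel_measurable_integrable[OF h]
    have "(\<lambda>k. \<integral>x. z k x * h x \<partial>M) \<longlonglongrightarrow> (\<integral>x. 0 \<partial>M)"
    proof (rule integral_dominated_convergence)
      show "integrable M (\<lambda>x. c * \<bar>h x\<bar>)" using h by simp
      show "AE x in M. (\<lambda>k. z k x * h x) \<longlonglongrightarrow> 0"
        using lim
      proof eventually_elim
        case (elim x)
        have "(\<lambda>k. z k x * h x) \<longlonglongrightarrow> (min (max (u x) 0) c - min (max (u x) 0) c) * h x"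
          unfolding z_def trunc_def by (intro tendsto_intros elim)
        then show ?case by simp
      qed
      show "AE x in M. norm (z k x * h x) \<le> c * \<bar>h x\<bar>" for k
      proof (intro AE_I2)
        fix x
        have "\<bar>z k x\<bar> \<le> c" using c by (auto simp: z_def trunc_def)
        then show "norm (z k x * h x) \<le> c * \<bar>h x\<bar>" by (simp add: abs_mult mult_right_mono)
      qed
    qed measurable
    then show "(\<lambda>k. \<integral>x. z k x * h x \<partial>M) \<longlonglongrightarrow> 0" by simp
  qed
  have D: "0 \<le> D" using form_nonneg[OF w] bound order_trans by blast
  have le: "E (?T u) (?T u) \<le> sqrt D * sqrt (E (?T u) (?T u)) - E (z k) (?T u)" for k
  proof -
    have "E (?T (w k)) (?T u) \<le> sqrt (E (?T (w k)) (?T (w k))) * sqrt (E (?T u) (?T u))"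
      using energy.cauchy_schwarz[OF Tw Tu, of k] by simp
    also have "\<dots> \<le> sqrt D * sqrt (E (?T u) (?T u))"
      using trunc_energy[OF c w[of k]] bound[of k] form_nonneg[OF Tu]
      by (intro mult_right_mono real_sqrt_le_mono) auto
    finally show ?thesis
      using energy.diff_left[OF Tw Tu Tu, of k] unfolding z_def by linarith
  qed
  have "(\<lambda>k. sqrt D * sqrt (E (?T u) (?T u)) - E (z k) (?T u))
      \<longlonglongrightarrow> sqrt D * sqrt (E (?T u) (?T u)) - 0"
    by (intro tendsto_intros null)
  from LIMSEQ_le_const[OF this] le have main: "E (?T u) (?T u) \<le> sqrt D * sqrt (E (?T u) (?T u))"
    by auto
  show ?thesis
  proof (cases "E (?T u) (?T u) = 0")
    case False
    then have "0 < sqrt (E (?T u) (?T u))" using form_nonneg[OF Tu] by simp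
    moreover have "sqrt (E (?T u) (?T u)) * sqrt (E (?T u) (?T u)) = E (?T u) (?T u)"
      using form_nonneg[OF Tu] by simp
    ultimately have "sqrt (E (?T u) (?T u)) \<le> sqrt D"
      using main by (metis mult_le_cancel_right_pos)
    then show ?thesis by simp
  qed (simp add: D)
qed

text \<open>
  Lower semicontinuity of the energy under convergence almost everywhere, up to the factor 4.
  The difference of the truncations of \<open>u\<close> and of \<open>- u\<close> at level \<open>n\<close> is \<open>u\<close> cut off at
  \<open>\<plusminus> n\<close>; its energy is at most \<open>4 * D\<close> by the previous lemma, and it tends to \<open>u\<close> weakly.
\<close>

lemma energy_le_of_AE_limit:
  assumes w: "\<And>k. w k \<in> F" and u: "u \<in> F" and lim: "AE x in M. (\<lambda>k. w k x) \<longlonglongrightarrow> u x"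
    and bound: "\<And>k. E (w k) (w k) \<le> D"
  shows "E u u \<le> 4 * D"
proof -
  have D: "0 \<le> D" using form_nonneg[OF w] bound order_trans by blast
  define a where "a n = trunc (real (Suc n)) u" for n
  define b where "b n = trunc (real (Suc n)) (\<lambda>x. (-1) * u x)" for n
  define v where "v n = (\<lambda>x. a n x - b n x)" for n
  define z where "z n = (\<lambda>x. v n x - u x)" for n
  have u': "(\<lambda>x. (-1) * u x) \<in> F" by (rule dom_scale[OF u])
  have aF: "a n \<in> F" and bF: "b n \<in> F" for n
    unfolding a_def b_def by (rule trunc_mem[OF _ u] trunc_mem[OF _ u'], simp)+
  have vF: "v n \<in> F" for n unfolding v_def by (rule energy.diff_mem[OF aF bF])
  have zF: "z n \<in> F" for n unfolding z_def by (rule energy.diff_mem[OF vF u])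
  note [measurable] = dom_measurable[OF u] dom_measurable[OF zF]
  have "E (a n) (a n) \<le> D" for n
    unfolding a_def by (rule trunc_energy_le_of_AE_limit[OF w u lim bound]) simp
  moreover have "E (b n) (b n) \<le> D" for n
    unfolding b_def
  proof (rule trunc_energy_le_of_AE_limit[OF dom_scale[OF w] u'])
    show "AE x in M. (\<lambda>k. (-1) * w k x) \<longlonglongrightarrow> (-1) * u x"
      using lim by eventually_elim (intro tendsto_intros)
    show "E (\<lambda>x. (-1) * w k x) (\<lambda>x. (-1) * w k x) \<le> D" for k
      using energy.square_scale[OF w, of "-1" k] bound[of k] by simp
  qed simp
  ultimately have vD: "E (v n) (v n) \<le> 4 * D" for n
    using energy.square_diff_le[OF aF bF, of n n] unfolding v_def
    by (smt (verit, best))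
  have "(\<lambda>n. E (z n) u) \<longlonglongrightarrow> 0"
  proof (rule weakly_null_if_null_against_L1_L2[OF zF _ _ u])
    show "E (z n) (z n) \<le> 2 * (4 * D) + 2 * E u u" for n
      using energy.square_diff_le[OF vF[of n] u] vD[of n] unfolding z_def by linarith
    fix h :: "'a \<Rightarrow> real"
    assume hL: "h \<in> Lq_space M 2" and h: "integrable M h"
    note [measurable] = borel_measurable_integrable[OF h]
    have "(\<lambda>n. \<integral>x. z n x * h x \<partial>M) \<longlonglongrightarrow> (\<integral>x. 0 \<partial>M)"
    proof (rule integral_dominated_convergence)
      show "integrable M (\<lambda>x. \<bar>u x * h x\<bar>)"
        using L2_integrable_mult[OF dom_Lq[OF u] hL] by (rule integrable_abs)
      show "AE x in M. (\<lambda>n. z n x * h x) \<longlonglongrightarrow> 0"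
      proof (rule AE_I2)
        fix x
        obtain N :: nat where N: "\<bar>u x\<bar> \<le> real N" using real_arch_simple by blast
        have "z n x * h x = 0" if "n \<ge> N" for n
        proof -
          have "\<bar>u x\<bar> \<le> real (Suc n)" using N that by linarith
          then show ?thesis by (auto simp: z_def v_def a_def b_def trunc_def)
        qed
        then have "\<forall>\<^sub>F n in sequentially. 0 = z n x * h x"
          by (intro eventually_sequentiallyI[of N]) simp
        then show "(\<lambda>n. z n x * h x) \<longlonglongrightarrow> 0" by (rule Lim_transform_eventually[OF tendsto_const])
      qed
      show "AE x in M. norm (z n x * h x) \<le> \<bar>u x * h x\<bar>" for n
      proof (intro AE_I2)
        fix x
        have "\<bar>z n x\<bar> \<le> \<bar>u x\<bar>" by (auto simp: z_def v_def a_def b_def trunc_def)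
        then show "norm (z n x * h x) \<le> \<bar>u x * h x\<bar>" by (simp add: abs_mult mult_right_mono)
      qed
    qed measurable
    then show "(\<lambda>n. \<integral>x. z n x * h x \<partial>M) \<longlonglongrightarrow> 0" by simp
  qed
  then have "(\<lambda>n. sqrt (4 * D) * sqrt (E u u) - E (z n) u) \<longlonglongrightarrow> sqrt (4 * D) * sqrt (E u u) - 0"
    by (intro tendsto_intros)
  moreover have "E u u \<le> sqrt (4 * D) * sqrt (E u u) - E (z n) u" for n
  proof -
    have "E (v n) u \<le> sqrt (E (v n) (v n)) * sqrt (E u u)"
      using energy.cauchy_schwarz[OF vF u, of n] by simp
    also have "\<dots> \<le> sqrt (4 * D) * sqrt (E u u)"
      using vD[of n] form_nonneg[OF u] by (intro mult_right_mono real_sqrt_le_mono) auto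
    finally show ?thesis using energy.diff_left[OF vF u u, of n] unfolding z_def by linarith
  qed
  ultimately have main: "E u u \<le> sqrt (4 * D) * sqrt (E u u)"
    using LIMSEQ_le_const by fastforce
  show ?thesis
  proof (cases "E u u = 0")
    case False
    then have "0 < sqrt (E u u)" using form_nonneg[OF u] by simp
    moreover have "sqrt (E u u) * sqrt (E u u) = E u u" using form_nonneg[OF u] by simp
    ultimately have "sqrt (E u u) \<le> sqrt (4 * D)"
      using main by (metis mult_le_cancel_right_pos)
    then show ?thesis by simp
  qed (simp add: D)
qed

text \<open>
  The energy is closable under convergence almost everywhere: \<open>w j\<close> is the limit of
  \<open>w j - w k\<close> as \<open>k\<close> grows, so its energy is at most four times a bound for the energies of these
  differences, which is small since the sequence is Cauchy.
\<close>

lemma null_sequence_energy: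
  assumes "approximates M F E w (\<lambda>x. 0)"
  shows "(\<lambda>k. E (w k) (w k)) \<longlonglongrightarrow> 0"
proof (rule LIMSEQ_I)
  have w: "w k \<in> F" for k using assms by (simp add: approximates_def)
  have lim: "AE x in M. (\<lambda>k. w k x) \<longlonglongrightarrow> 0" using assms by (simp add: approximates_def)
  fix e :: real assume e: "e > 0"
  then obtain N where N: "\<And>k l. k \<ge> N \<Longrightarrow> l \<ge> N \<Longrightarrow>
      E (\<lambda>x. w k x - w l x) (\<lambda>x. w k x - w l x) < e / 5"
    using assms unfolding approximates_def by (metis zero_less_divide_iff zero_less_numeral)
  have "norm (E (w j) (w j) - 0) < e" if j: "j \<ge> N" for j
  proof -
    have "E (w j) (w j) \<le> 4 * (e / 5)"
    proof (rule energy_le_of_AE_limit)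
      show "(\<lambda>x. w j x - w (k + N) x) \<in> F" for k by (rule energy.diff_mem[OF w w])
      show "w j \<in> F" by (rule w)
      show "AE x in M. (\<lambda>k. w j x - w (k + N) x) \<longlonglongrightarrow> w j x"
        using lim
      proof eventually_elim
        case (elim x)
        have "(\<lambda>k. w j x - w (k + N) x) \<longlonglongrightarrow> w j x - 0"
          by (intro tendsto_intros LIMSEQ_ignore_initial_segment elim)
        then show ?case by simp
      qed
      show "E (\<lambda>x. w j x - w (k + N) x) (\<lambda>x. w j x - w (k + N) x) \<le> e / 5" for k
        using N[OF j, of "k + N"] by simp
    qed
    then show ?thesis using form_nonneg[OF w] e by simp
  qed
  then show "\<exists>no. \<forall>k\<ge>no. norm (E (w k) (w k) - 0) < e" by blast
qed

section \<open>The extended Dirichlet space\<close>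

abbreviation Fe :: "('a \<Rightarrow> real) set" where
  "Fe \<equiv> extended_domain M F E"

abbreviation Q :: "('a \<Rightarrow> real) \<Rightarrow> real" where
  "Q \<equiv> extended_energy M F E"

lemma approximates_dom: "approximates M F E s u \<Longrightarrow> s k \<in> F"
  by (simp add: approximates_def)

lemma approximates_cauchy:
  assumes "approximates M F E s u" "e > 0"
  obtains N where "\<And>k l. k \<ge> N \<Longrightarrow> l \<ge> N \<Longrightarrow> E (\<lambda>x. s k x - s l x) (\<lambda>x. s k x - s l x) < e"
  using assms unfolding approximates_def by blast

lemma approximates_AE: "approximates M F E s u \<Longrightarrow> AE x in M. (\<lambda>k. s k x) \<longlonglongrightarrow> u x"
  by (simp add: approximates_def)

lemma approximates_ae:
  assumes "approximates M F E s u" "AE x in M. u x = v x"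
  shows "approximates M F E s v"
proof -
  have "AE x in M. (\<lambda>k. s k x) \<longlonglongrightarrow> v x"
    using approximates_AE[OF assms(1)] assms(2) by eventually_elim simp
  then show ?thesis using assms(1) by (simp add: approximates_def)
qed

lemma approximates_const:
  assumes "u \<in> F"
  shows "approximates M F E (\<lambda>_. u) u"
  using assms energy.zero_left[OF dom_zero] by (simp add: approximates_def)

lemma approximates_diff:
  assumes s: "approximates M F E s u" and t: "approximates M F E t v"
  shows "approximates M F E (\<lambda>k x. s k x - t k x) (\<lambda>x. u x - v x)"
  unfolding approximates_def
proof (intro conjI allI impI)
  note sF = approximates_dom[OF s] and tF = approximates_dom[OF t]
  show "(\<lambda>x. s k x - t k x) \<in> F" for k by (rule energy.diff_mem[OF sF tF])
  show "AE x in M. (\<lambda>k. s k x - t k x) \<longlonglongrightarrow> u x - v x"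
    using approximates_AE[OF s] approximates_AE[OF t] by eventually_elim (intro tendsto_intros)
  fix e :: real assume e: "e > 0"
  obtain N1 where N1: "\<And>k l. k \<ge> N1 \<Longrightarrow> l \<ge> N1 \<Longrightarrow> E (\<lambda>x. s k x - s l x) (\<lambda>x. s k x - s l x) < e / 4"
    using approximates_cauchy[OF s, of "e / 4"] e by auto
  obtain N2 where N2: "\<And>k l. k \<ge> N2 \<Longrightarrow> l \<ge> N2 \<Longrightarrow> E (\<lambda>x. t k x - t l x) (\<lambda>x. t k x - t l x) < e / 4"
    using approximates_cauchy[OF t, of "e / 4"] e by auto
  have "E (\<lambda>x. (s k x - t k x) - (s l x - t l x)) (\<lambda>x. (s k x - t k x) - (s l x - t l x)) < e"
    if "k \<ge> max N1 N2" "l \<ge> max N1 N2" for k l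
  proof -
    have eq: "(\<lambda>x. (s k x - t k x) - (s l x - t l x)) = (\<lambda>x. (s k x - s l x) - (t k x - t l x))"
      by (simp add: algebra_simps)
    show ?thesis
      unfolding eq
      using energy.square_diff_le[OF energy.diff_mem[OF sF sF] energy.diff_mem[OF tF tF], of k l k l]
        N1[of k l] N2[of k l] that by simp
  qed
  then show "\<exists>N. \<forall>k\<ge>N. \<forall>l\<ge>N.
      E (\<lambda>x. (s k x - t k x) - (s l x - t l x)) (\<lambda>x. (s k x - t k x) - (s l x - t l x)) < e"
    by blast
qed

lemma approximates_scale:
  assumes s: "approximates M F E s u"
  shows "approximates M F E (\<lambda>k x. c * s k x) (\<lambda>x. c * u x)"
  unfolding approximates_def
proof (intro conjI allI impI)
  note sF = approximates_dom[OF s]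
  show "(\<lambda>x. c * s k x) \<in> F" for k by (rule dom_scale[OF sF])
  show "AE x in M. (\<lambda>k. c * s k x) \<longlonglongrightarrow> c * u x"
    using approximates_AE[OF s] by eventually_elim (intro tendsto_intros)
  fix e :: real assume e: "e > 0"
  have c: "c\<^sup>2 + 1 > 0" by (simp add: add_nonneg_pos)
  obtain N where N: "\<And>k l. k \<ge> N \<Longrightarrow> l \<ge> N \<Longrightarrow>
      E (\<lambda>x. s k x - s l x) (\<lambda>x. s k x - s l x) < e / (c\<^sup>2 + 1)"
    using approximates_cauchy[OF s, of "e / (c\<^sup>2 + 1)"] e c by auto
  have "E (\<lambda>x. c * s k x - c * s l x) (\<lambda>x. c * s k x - c * s l x) < e"
    if kl: "k \<ge> N" "l \<ge> N" for k l
  proof -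
    have d: "(\<lambda>x. s k x - s l x) \<in> F" by (rule energy.diff_mem[OF sF sF])
    have "E (\<lambda>x. c * s k x - c * s l x) (\<lambda>x. c * s k x - c * s l x) =
        c\<^sup>2 * E (\<lambda>x. s k x - s l x) (\<lambda>x. s k x - s l x)"
      using energy.square_scale[OF d, of c] by (simp add: right_diff_distrib)
    also have "\<dots> \<le> (c\<^sup>2 + 1) * E (\<lambda>x. s k x - s l x) (\<lambda>x. s k x - s l x)"
      using form_nonneg[OF d] by (intro mult_right_mono) auto
    also have "\<dots> < (c\<^sup>2 + 1) * (e / (c\<^sup>2 + 1))"
      using N[OF kl] c by (intro mult_strict_left_mono)
    also have "\<dots> = e" using c by simp
    finally show ?thesis .
  qed
  then show "\<exists>N. \<forall>k\<ge>N. \<forall>l\<ge>N.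
      E (\<lambda>x. c * s k x - c * s l x) (\<lambda>x. c * s k x - c * s l x) < e" by blast
qed

lemma approximates_add:
  assumes s: "approximates M F E s u" and t: "approximates M F E t v"
  shows "approximates M F E (\<lambda>k x. s k x + t k x) (\<lambda>x. u x + v x)"
  using approximates_diff[OF s approximates_scale[OF t, of "-1"]] by simp

lemma approximates_energy_convergent:
  assumes s: "approximates M F E s u"
  shows "convergent (\<lambda>k. E (s k) (s k))"
proof -
  note sF = approximates_dom[OF s]
  have "Cauchy (\<lambda>k. sqrt (E (s k) (s k)))"
  proof (rule metric_CauchyI)
    fix e :: real assume e: "e > 0"
    obtain N where N: "\<And>k l. k \<ge> N \<Longrightarrow> l \<ge> N \<Longrightarrow>
        E (\<lambda>x. s k x - s l x) (\<lambda>x. s k x - s l x) < e\<^sup>2"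
      using approximates_cauchy[OF s, of "e\<^sup>2"] e by auto
    have "dist (sqrt (E (s k) (s k))) (sqrt (E (s l) (s l))) < e" if "k \<ge> N" "l \<ge> N" for k l
    proof -
      have "dist (sqrt (E (s k) (s k))) (sqrt (E (s l) (s l))) \<le>
          sqrt (E (\<lambda>x. s k x - s l x) (\<lambda>x. s k x - s l x))"
        using energy.norm_reverse_triangle[OF sF sF] by (simp add: dist_real_def)
      also have "\<dots> < e" using N[OF that] e by (intro real_less_lsqrt) auto
      finally show ?thesis .
    qed
    then show "\<exists>N. \<forall>k\<ge>N. \<forall>l\<ge>N. dist (sqrt (E (s k) (s k))) (sqrt (E (s l) (s l))) < e" by blast
  qed
  then obtain a where "(\<lambda>k. sqrt (E (s k) (s k))) \<longlonglongrightarrow> a"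
    using Cauchy_convergent convergent_def by blast
  then have "(\<lambda>k. (sqrt (E (s k) (s k)))\<^sup>2) \<longlonglongrightarrow> a\<^sup>2" by (intro tendsto_power)
  then show ?thesis using form_nonneg[OF sF] by (auto simp: convergent_def)
qed

text \<open>
  The energy on the extended domain is well defined: the difference of two approximating
  sequences approximates 0.
\<close>

lemma approximates_energy_limit_unique:
  assumes s: "approximates M F E s u" and t: "approximates M F E t u"
    and a: "(\<lambda>k. E (s k) (s k)) \<longlonglongrightarrow> a" and b: "(\<lambda>k. E (t k) (t k)) \<longlonglongrightarrow> b"
  shows "a = b"
proof -
  note sF = approximates_dom[OF s] and tF = approximates_dom[OF t]
  have "(\<lambda>k. E (\<lambda>x. s k x - t k x) (\<lambda>x. s k x - t k x)) \<longlonglongrightarrow> 0"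
    using approximates_diff[OF s t] by (intro null_sequence_energy) simp
  then have "(\<lambda>k. sqrt (E (\<lambda>x. s k x - t k x) (\<lambda>x. s k x - t k x))) \<longlonglongrightarrow> sqrt 0"
    by (intro tendsto_real_sqrt)
  then have 0: "(\<lambda>k. sqrt (E (\<lambda>x. s k x - t k x) (\<lambda>x. s k x - t k x))) \<longlonglongrightarrow> 0" by simp
  have "(\<lambda>k. sqrt (E (s k) (s k)) - sqrt (E (t k) (t k))) \<longlonglongrightarrow> 0"
    by (rule Lim_null_comparison[OF _ 0]) (simp add: energy.norm_reverse_triangle[OF sF tF])
  moreover have "(\<lambda>k. sqrt (E (s k) (s k)) - sqrt (E (t k) (t k))) \<longlonglongrightarrow> sqrt a - sqrt b"
    by (intro tendsto_intros a b)
  ultimately have "sqrt a - sqrt b = 0" using LIMSEQ_unique by blast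
  then show ?thesis by simp
qed

lemma extended_energy_limit:
  assumes s: "approximates M F E s u"
  shows "(\<lambda>k. E (s k) (s k)) \<longlonglongrightarrow> Q u"
proof -
  obtain a where a: "(\<lambda>k. E (s k) (s k)) \<longlonglongrightarrow> a"
    using approximates_energy_convergent[OF s] by (auto simp: convergent_def)
  have "Q u = a"
    unfolding extended_energy_def
    using s a approximates_energy_limit_unique by (intro the_equality) blast+
  with a show ?thesis by simp
qed

lemma Fe_E:
  assumes "u \<in> Fe"
  obtains s where "approximates M F E s u"
  using assms by (auto simp: extended_domain_def)

lemma Fe_measurable: "u \<in> Fe \<Longrightarrow> u \<in> borel_measurable M"
  by (simp add: extended_domain_def)

lemma Fe_ae: "u \<in> Fe \<Longrightarrow> v \<in> borel_measurable M \<Longrightarrow> AE x in M. u x = v x \<Longrightarrow> v \<in> Fe"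
  using approximates_ae by (auto simp: extended_domain_def)

lemma Q_ae:
  assumes "AE x in M. u x = v x"
  shows "Q u = Q v"
proof -
  have "approximates M F E s u \<longleftrightarrow> approximates M F E s v" for s
    using assms approximates_ae by (metis (mono_tags, lifting) AE_cong)
  then show ?thesis by (simp add: extended_energy_def)
qed

lemma dom_Fe: "u \<in> F \<Longrightarrow> u \<in> Fe"
  using approximates_const dom_measurable by (auto simp: extended_domain_def)

lemma Q_dom: "u \<in> F \<Longrightarrow> Q u = E u u"
  using extended_energy_limit[OF approximates_const[of u]] by (simp add: LIMSEQ_const_iff)

lemma Q_zero: "Q (\<lambda>x. 0) = 0"
  using Q_dom[OF dom_zero] energy.zero_left[OF dom_zero] by simp

lemma Fe_add: "u \<in> Fe \<Longrightarrow> v \<in> Fe \<Longrightarrow> (\<lambda>x. u x + v x) \<in> Fe"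
  unfolding extended_domain_def by clarsimp (blast intro: approximates_add)

lemma Fe_scale: "u \<in> Fe \<Longrightarrow> (\<lambda>x. c * u x) \<in> Fe"
  using approximates_scale by (auto simp: extended_domain_def)

lemma Fe_diff: "u \<in> Fe \<Longrightarrow> v \<in> Fe \<Longrightarrow> (\<lambda>x. u x - v x) \<in> Fe"
  unfolding extended_domain_def by clarsimp (blast intro: approximates_diff)

lemma Q_nonneg:
  assumes "u \<in> Fe"
  shows "0 \<le> Q u"
proof -
  obtain s where s: "approximates M F E s u" using Fe_E[OF assms] .
  show ?thesis
    using form_nonneg[OF approximates_dom[OF s]] by (intro LIMSEQ_le_const[OF extended_energy_limit[OF s]]) simp
qed

lemma Q_scale:
  assumes "u \<in> Fe"
  shows "Q (\<lambda>x. c * u x) = c\<^sup>2 * Q u"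
proof -
  obtain s where s: "approximates M F E s u" using Fe_E[OF assms] .
  have "(\<lambda>k. E (\<lambda>x. c * s k x) (\<lambda>x. c * s k x)) \<longlonglongrightarrow> c\<^sup>2 * Q u"
    using tendsto_mult[OF tendsto_const extended_energy_limit[OF s], of "c\<^sup>2"]
    by (simp add: energy.square_scale[OF approximates_dom[OF s]])
  then show ?thesis
    using extended_energy_limit[OF approximates_scale[OF s]] LIMSEQ_unique by blast
qed

lemma sqrt_Q_triangle:
  assumes "u \<in> Fe" "v \<in> Fe"
  shows "sqrt (Q (\<lambda>x. u x + v x)) \<le> sqrt (Q u) + sqrt (Q v)"
proof -
  obtain s where s: "approximates M F E s u" using Fe_E[OF assms(1)] .
  obtain t where t: "approximates M F E t v" using Fe_E[OF assms(2)] .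
  show ?thesis
  proof (rule LIMSEQ_le)
    show "(\<lambda>k. sqrt (E (\<lambda>x. s k x + t k x) (\<lambda>x. s k x + t k x))) \<longlonglongrightarrow> sqrt (Q (\<lambda>x. u x + v x))"
      by (intro tendsto_real_sqrt extended_energy_limit approximates_add s t)
    show "(\<lambda>k. sqrt (E (s k) (s k)) + sqrt (E (t k) (t k))) \<longlonglongrightarrow> sqrt (Q u) + sqrt (Q v)"
      by (intro tendsto_intros extended_energy_limit s t)
  qed (use energy.norm_triangle[OF approximates_dom[OF s] approximates_dom[OF t]] in blast)
qed

lemma sqrt_Q_diff_triangle:
  assumes "u \<in> Fe" "v \<in> Fe" "w \<in> Fe"
  shows "sqrt (Q (\<lambda>x. u x - w x)) \<le> sqrt (Q (\<lambda>x. u x - v x)) + sqrt (Q (\<lambda>x. v x - w x))"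
  using sqrt_Q_triangle[OF Fe_diff[OF assms(1,2)] Fe_diff[OF assms(2,3)]] by simp

lemma Q_diff_commute:
  assumes "u \<in> Fe" "v \<in> Fe"
  shows "Q (\<lambda>x. u x - v x) = Q (\<lambda>x. v x - u x)"
  using Q_scale[OF Fe_diff[OF assms], of "-1"] by simp

lemma approximates_in_energy:
  assumes s: "approximates M F E s u"
  shows "(\<lambda>k. Q (\<lambda>x. u x - s k x)) \<longlonglongrightarrow> 0"
proof (rule LIMSEQ_I)
  fix e :: real assume e: "e > 0"
  note sF = approximates_dom[OF s]
  obtain N where N: "\<And>k l. k \<ge> N \<Longrightarrow> l \<ge> N \<Longrightarrow>
      E (\<lambda>x. s k x - s l x) (\<lambda>x. s k x - s l x) < e / 2"
    using approximates_cauchy[OF s, of "e / 2"] e by auto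
  have "norm (Q (\<lambda>x. u x - s k x) - 0) < e" if k: "k \<ge> N" for k
  proof -
    have lim: "(\<lambda>l. E (\<lambda>x. s l x - s k x) (\<lambda>x. s l x - s k x)) \<longlonglongrightarrow> Q (\<lambda>x. u x - s k x)"
      by (rule extended_energy_limit[OF approximates_diff[OF s approximates_const[OF sF]]])
    have "Q (\<lambda>x. u x - s k x) \<le> e / 2"
      using N[OF _ k] by (intro LIMSEQ_le_const2[OF lim] exI[of _ N]) (simp add: less_imp_le)
    moreover have "0 \<le> Q (\<lambda>x. u x - s k x)"
      using form_nonneg[OF energy.diff_mem[OF sF sF]] by (intro LIMSEQ_le_const[OF lim]) simp
    ultimately show ?thesis using e by simp
  qed
  then show "\<exists>no. \<forall>k\<ge>no. norm (Q (\<lambda>x. u x - s k x) - 0) < e" by blast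
qed

end

text \<open>
  Convergence almost everywhere on a sigma-finite space implies convergence in the metric
  \<open>\<integral> min 1 \<bar>u - v\<bar> * g\<close> with an integrable weight \<open>g > 0\<close>, and the converse holds along a
  subsequence. In a metric a diagonal sequence can be chosen. The predicate \<open>P\<close> carries
  whatever else the chosen terms should satisfy.
\<close>

lemma (in sigma_finite_measure) AE_diagonal_subsequence:
  fixes u :: "nat \<Rightarrow> 'a \<Rightarrow> real" and s :: "nat \<Rightarrow> nat \<Rightarrow> 'a \<Rightarrow> real"
  assumes u: "\<And>n. u n \<in> borel_measurable M" and s: "\<And>n k. s n k \<in> borel_measurable M"
    and lim: "\<And>n. AE x in M. (\<lambda>k. s n k x) \<longlonglongrightarrow> u n x"
    and P: "\<And>n. \<forall>\<^sub>F k in sequentially. P n k"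
  obtains j r where "\<And>n. P n (j n)" "strict_mono (r :: nat \<Rightarrow> nat)"
    "AE x in M. (\<lambda>n. u (r n) x - s (r n) (j (r n)) x) \<longlonglongrightarrow> 0"
proof -
  note [measurable] = u s
  obtain h where h: "h \<in> borel_measurable M" "integral\<^sup>N M h \<noteq> \<infinity>"
      "\<And>x. x \<in> space M \<Longrightarrow> 0 < h x \<and> h x < \<infinity>"
    using Ex_finite_integrable_function by blast
  note [measurable] = h(1)
  define g where "g x = enn2real (h x)" for x
  have [measurable]: "g \<in> borel_measurable M" unfolding g_def by measurable
  have g: "0 < g x" "ennreal (g x) = h x" if "x \<in> space M" for x
    using h(3)[OF that] by (auto simp: g_def enn2real_positive_iff)
  have g0: "0 \<le> g x" for x by (simp add: g_def)
  have gi: "integrable M g"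
  proof (rule integrableI_nonneg)
    have "(\<integral>\<^sup>+x. ennreal (g x) \<partial>M) = integral\<^sup>N M h" by (rule nn_integral_cong) (rule g(2))
    then show "(\<integral>\<^sup>+x. ennreal (g x) \<partial>M) < \<infinity>" using h(2) by (simp add: top.not_eq_extremum)
  qed (auto simp: g0)
  define f where "f n k x = min 1 \<bar>u n x - s n k x\<bar> * g x" for n k x
  have f0: "0 \<le> f n k x" for n k x using g0 by (simp add: f_def)
  have f_le: "norm (f n k x) \<le> g x" for n k x
    using mult_right_mono[OF min.cobounded1 g0, of 1 "\<bar>u n x - s n k x\<bar>" x] f0 by (simp add: f_def)
  have fm [measurable]: "f n k \<in> borel_measurable M" for n k unfolding f_def by measurable
  have fi: "integrable M (f n k)" for n k
    by (rule Bochner_Integration.integrable_bound[OF gi fm]) (use f_le g0 in simp)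
  have f_lim: "(\<lambda>k. \<integral>x. f n k x \<partial>M) \<longlonglongrightarrow> 0" for n
  proof -
    have "(\<lambda>k. \<integral>x. f n k x \<partial>M) \<longlonglongrightarrow> (\<integral>x. 0 \<partial>M)"
    proof (rule integral_dominated_convergence)
      show "integrable M g" by (rule gi)
      show "AE x in M. (\<lambda>k. f n k x) \<longlonglongrightarrow> 0"
        using lim[of n]
      proof eventually_elim
        case (elim x)
        have "(\<lambda>k. f n k x) \<longlonglongrightarrow> min 1 \<bar>u n x - u n x\<bar> * g x"
          unfolding f_def by (intro tendsto_intros elim)
        then show ?case by simp
      qed
      show "AE x in M. norm (f n k x) \<le> g x" for k using f_le by simp
    qed measurable
    then show ?thesis by simp
  qed
  have "\<exists>k. P n k \<and> (\<integral>x. f n k x \<partial>M) < 1 / Suc n" for n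
  proof -
    have "\<forall>\<^sub>F k in sequentially. (\<integral>x. f n k x \<partial>M) < 1 / Suc n"
      by (rule order_tendstoD(2)[OF f_lim]) simp
    from eventually_conj[OF P[of n] this] show ?thesis
      by (auto simp: eventually_sequentially)
  qed
  then obtain j where j: "\<And>n. P n (j n)" "\<And>n. (\<integral>x. f n (j n) x \<partial>M) < 1 / Suc n" by metis
  have "(\<lambda>n. \<integral>x. norm (f n (j n) x) \<partial>M) \<longlonglongrightarrow> 0"
  proof (rule tendsto_sandwich[OF _ _ tendsto_const])
    show "(\<lambda>n. 1 / Suc n) \<longlonglongrightarrow> (0::real)"
      using LIMSEQ_inverse_real_of_nat by (simp add: inverse_eq_divide)
  qed (use j(2) f0 in \<open>auto intro!: always_eventually less_imp_le\<close>)
  from tendsto_L1_AE_subseq[OF fi this] obtain r where r: "strict_mono r"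
      "AE x in M. (\<lambda>n. f (r n) (j (r n)) x) \<longlonglongrightarrow> 0"
    by blast
  have "AE x in M. (\<lambda>n. u (r n) x - s (r n) (j (r n)) x) \<longlonglongrightarrow> 0"
    using r(2) AE_space
  proof eventually_elim
    case (elim x)
    define a where "a n = \<bar>u (r n) x - s (r n) (j (r n)) x\<bar>" for n
    have gx: "0 < g x" by (rule g(1)[OF elim(2)])
    have "(\<lambda>n. f (r n) (j (r n)) x / g x) \<longlonglongrightarrow> 0 / g x"
      by (intro tendsto_intros elim(1)) (use gx in simp)
    then have ma: "(\<lambda>n. min 1 (a n)) \<longlonglongrightarrow> 0" using gx by (simp add: f_def a_def)
    have "\<forall>\<^sub>F n in sequentially. min 1 (a n) = a n"
      using order_tendstoD(2)[OF ma, of 1] by (auto elim!: eventually_mono)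
    then have "a \<longlonglongrightarrow> 0" by (rule Lim_transform_eventually[OF ma])
    then show ?case unfolding a_def by (simp add: tendsto_rabs_zero_iff)
  qed
  with j r show ?thesis using that by blast
qed

context dirichlet_form
begin

text \<open>
  Pick \<open>w n\<close> in the domain close to a term of the sequence both in energy and in the sense of
  the diagonal lemma. Then \<open>w\<close> has Cauchy energy and tends to \<open>v\<close> almost everywhere, so it
  witnesses \<open>v \<in> Fe\<close>, and it tends to \<open>v\<close> in energy.
\<close>

lemma extended_complete:
  assumes sigma: "sigma_finite_measure M"
    and u: "\<And>n. u n \<in> Fe" and lim: "AE x in M. (\<lambda>n. u n x) \<longlonglongrightarrow> v x"
    and v: "v \<in> borel_measurable M"
    and cau: "\<And>e. e > 0 \<Longrightarrow> \<exists>N. \<forall>m\<ge>N. \<forall>n\<ge>N. sqrt (Q (\<lambda>x. u m x - u n x)) < e"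
  shows "v \<in> Fe" and "(\<lambda>n. sqrt (Q (\<lambda>x. u n x - v x))) \<longlonglongrightarrow> 0"
proof -
  have "\<exists>s. approximates M F E s (u n)" for n using u[of n] by (simp add: extended_domain_def)
  then obtain s where s: "\<And>n. approximates M F E (s n) (u n)" by metis
  note sF = approximates_dom[OF s]
  have ev: "\<forall>\<^sub>F k in sequentially. Q (\<lambda>x. u n x - s n k x) < (1 / Suc n)\<^sup>2" for n
    by (rule order_tendstoD(2)[OF approximates_in_energy[OF s]]) simp
  obtain j r where j: "\<And>n. Q (\<lambda>x. u n x - s n (j n) x) < (1 / Suc n)\<^sup>2"
    and r: "strict_mono (r :: nat \<Rightarrow> nat)"
    and diff: "AE x in M. (\<lambda>n. u (r n) x - s (r n) (j (r n)) x) \<longlonglongrightarrow> 0"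
    by (rule sigma_finite_measure.AE_diagonal_subsequence[where u = u and s = s,
          OF sigma Fe_measurable[OF u] dom_measurable[OF sF] approximates_AE[OF s] ev])
       (rule that)
  define w where "w n = s (r n) (j (r n))" for n
  have wF: "w n \<in> F" for n unfolding w_def by (rule sF)
  have uw: "sqrt (Q (\<lambda>x. u (r n) x - w n x)) < 1 / Suc n" for n
  proof -
    have "sqrt (Q (\<lambda>x. u (r n) x - w n x)) < 1 / Suc (r n)"
      using j[of "r n"] unfolding w_def by (intro real_less_lsqrt) auto
    also have "\<dots> \<le> 1 / Suc n" using seq_suble[OF r, of n] by (intro divide_left_mono) auto
    finally show ?thesis .
  qed
  have w: "approximates M F E w v"
    unfolding approximates_def
  proof (intro conjI allI impI wF)
    show "AE x in M. (\<lambda>k. w k x) \<longlonglongrightarrow> v x"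
      using lim diff
    proof eventually_elim
      case (elim x)
      have "(\<lambda>n. u (r n) x - (u (r n) x - s (r n) (j (r n)) x)) \<longlonglongrightarrow> v x - 0"
        using LIMSEQ_subseq_LIMSEQ[OF elim(1) r] by (intro tendsto_diff elim(2)) (simp add: o_def)
      then show ?case by (simp add: w_def)
    qed
    fix e :: real assume e: "e > 0"
    have se: "sqrt e / 3 > 0" using e by simp
    obtain N1 where N1: "\<And>m n. m \<ge> N1 \<Longrightarrow> n \<ge> N1 \<Longrightarrow> sqrt (Q (\<lambda>x. u m x - u n x)) < sqrt e / 3"
      using cau[OF se] by blast
    obtain N2 where N2: "1 / Suc N2 < sqrt e / 3" using nat_approx_posE[OF se] .
    have "E (\<lambda>x. w k x - w l x) (\<lambda>x. w k x - w l x) < e" if kl: "k \<ge> max N1 N2" "l \<ge> max N1 N2" for k l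
    proof -
      have "1 / Suc k \<le> 1 / Suc N2" "1 / Suc l \<le> 1 / Suc N2"
        using kl by (auto intro!: divide_left_mono)
      then have 1: "sqrt (Q (\<lambda>x. u (r k) x - w k x)) < sqrt e / 3"
          "sqrt (Q (\<lambda>x. u (r l) x - w l x)) < sqrt e / 3"
        using uw[of k] uw[of l] N2 by linarith+
      have "r k \<ge> N1" "r l \<ge> N1" using kl seq_suble[OF r, of k] seq_suble[OF r, of l] by auto
      then have 2: "sqrt (Q (\<lambda>x. u (r k) x - u (r l) x)) < sqrt e / 3" by (rule N1)
      have "sqrt (Q (\<lambda>x. w k x - w l x)) \<le>
          sqrt (Q (\<lambda>x. w k x - u (r k) x)) + sqrt (Q (\<lambda>x. u (r k) x - w l x))"
        by (rule sqrt_Q_diff_triangle[OF dom_Fe[OF wF] u dom_Fe[OF wF]])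
      also have "\<dots> \<le> sqrt (Q (\<lambda>x. w k x - u (r k) x)) +
          (sqrt (Q (\<lambda>x. u (r k) x - u (r l) x)) + sqrt (Q (\<lambda>x. u (r l) x - w l x)))"
        by (intro add_left_mono sqrt_Q_diff_triangle[OF u u dom_Fe[OF wF]])
      also have "\<dots> < sqrt e"
        using 1 2 Q_diff_commute[OF dom_Fe[OF wF] u, of k "r k"] by simp
      finally show ?thesis
        using Q_dom[OF energy.diff_mem[OF wF wF]] by simp
    qed
    then show "\<exists>N. \<forall>k\<ge>N. \<forall>l\<ge>N. E (\<lambda>x. w k x - w l x) (\<lambda>x. w k x - w l x) < e" by blast
  qed
  then show vF: "v \<in> Fe" using v by (auto simp: extended_domain_def)
  have limr: "(\<lambda>n. sqrt (Q (\<lambda>x. u (r n) x - v x))) \<longlonglongrightarrow> 0"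
  proof (rule tendsto_sandwich[OF _ _ tendsto_const])
    have "(\<lambda>n. 1 / real (Suc n) + sqrt (Q (\<lambda>x. v x - w n x))) \<longlonglongrightarrow> 0 + sqrt 0"
      using LIMSEQ_inverse_real_of_nat
      by (intro tendsto_add tendsto_real_sqrt approximates_in_energy[OF w]) (simp add: inverse_eq_divide)
    then show "(\<lambda>n. 1 / real (Suc n) + sqrt (Q (\<lambda>x. v x - w n x))) \<longlonglongrightarrow> 0" by simp
    have "sqrt (Q (\<lambda>x. u (r n) x - v x)) \<le> 1 / Suc n + sqrt (Q (\<lambda>x. v x - w n x))" for n
      using sqrt_Q_diff_triangle[OF u dom_Fe[OF wF] vF, of "r n" n] uw[of n]
        Q_diff_commute[OF dom_Fe[OF wF] vF, of n] by simp
    then show "\<forall>\<^sub>F n in sequentially. sqrt (Q (\<lambda>x. u (r n) x - v x)) \<le>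
        1 / real (Suc n) + sqrt (Q (\<lambda>x. v x - w n x))" by simp
  qed (use Q_nonneg[OF Fe_diff[OF u vF]] in simp)
  show "(\<lambda>n. sqrt (Q (\<lambda>x. u n x - v x))) \<longlonglongrightarrow> 0"
  proof (rule cauchy_tendsto_zero_if_subseq[OF _ _ _ r limr])
    show "0 \<le> sqrt (Q (\<lambda>x. u n x - v x))" for n using Q_nonneg[OF Fe_diff[OF u vF]] by simp
    show "sqrt (Q (\<lambda>x. u n x - v x)) \<le> sqrt (Q (\<lambda>x. u n x - u k x)) + sqrt (Q (\<lambda>x. u k x - v x))" for n k
      by (rule sqrt_Q_diff_triangle[OF u u vF])
  qed (fact cau)
qed

end

section \<open>Metric measure spaces are sigma-finite\<close>

text \<open>
  The compact balls of radius \<open>1 / Suc n\<close> around the points of a countable dense set cover the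
  space: near a point with a compact neighbourhood, small closed balls are compact.
\<close>

lemma metric_measure_space_sigma_finite:
  fixes M :: "'a::metric_space measure"
  assumes "metric_measure_space M"
  shows "sigma_finite_measure M"
proof
  have lc: "locally_compact_space (euclidean :: 'a topology)"
    and "separable_space (euclidean :: 'a topology)"
    and sets: "sets M = sets borel"
    and fin: "\<And>K. compact K \<Longrightarrow> emeasure M K < \<infinity>"
    using assms by (auto simp: metric_measure_space_def radon_measure_def)
  then obtain D :: "'a set" where D: "countable D" "closure D = UNIV"
    by (auto simp: separable_space_def)
  define A where "A = {cball d (1 / Suc n) |d n. d \<in> D \<and> compact (cball d (1 / Suc n))}"
  have "A \<subseteq> (\<lambda>(d, n). cball d (1 / Suc n)) ` (D \<times> UNIV)" by (auto simp: A_def)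
  then have count: "countable A"
    using D(1) by (meson countable_SIGMA countable_image countable_subset countableI_type)
  have "x \<in> \<Union>A" for x
  proof -
    obtain U K where UK: "open U" "compact K" "x \<in> U" "U \<subseteq> K"
      using lc[unfolded locally_compact_space_def, rule_format, of x] by auto
    obtain e where e: "e > 0" "ball x e \<subseteq> U" using UK(1,3) open_contains_ball by blast
    have "e / 2 > 0" using e by simp
    then obtain n where n: "1 / Suc n < e / 2" using nat_approx_posE by blast
    have "x \<in> closure D" using D by simp
    then obtain d where d: "d \<in> D" "dist d x < 1 / Suc n"
      unfolding closure_approachable by (metis of_nat_0_less_iff zero_less_Suc zero_less_divide_1_iff)
    have "cball d (1 / Suc n) \<subseteq> ball x e"
    proof
      fix y assume "y \<in> cball d (1 / Suc n)"
      then have "dist x y < e"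
        using dist_triangle[of x y d] d(2) n by (simp add: dist_commute)
      then show "y \<in> ball x e" by simp
    qed
    then have "cball d (1 / Suc n) = K \<inter> cball d (1 / Suc n)" using e UK by blast
    then have "compact (cball d (1 / Suc n))"
      using compact_Int_closed[OF UK(2) closed_cball] by metis
    then have "cball d (1 / Suc n) \<in> A" unfolding A_def using d(1) by blast
    moreover have "x \<in> cball d (1 / Suc n)" using d(2) by simp
    ultimately show ?thesis by blast
  qed
  then have "\<Union>A = space M" using sets_eq_imp_space_eq[OF sets] by auto
  moreover have "a \<in> sets M \<and> emeasure M a \<noteq> \<infinity>" if "a \<in> A" for a
  proof -
    have "compact a" using that by (auto simp: A_def)
    then show ?thesis using borel_compact[of a] fin[of a] by (simp add: sets less_top)
  qed
  ultimately show "\<exists>A. countable A \<and> A \<subseteq> sets M \<and> \<Union>A = space M \<and> (\<forall>a\<in>A. emeasure M a \<noteq> \<infinity>)"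
    using count by blast
qed

section \<open>The space of q-integrable functions of finite energy\<close>

context dirichlet_form
begin

lemma Vq_space_iff: "u \<in> Vq_space M F E q \<longleftrightarrow> u \<in> Lq_space M q \<and> u \<in> Fe"
  by (simp add: Vq_space_def)

lemma Lq_norm_le_Vq_norm: "u \<in> Fe \<Longrightarrow> Lq_norm M q u \<le> Vq_norm M F E q u"
  unfolding Vq_norm_def using Q_nonneg[of u] by (intro real_le_rsqrt) simp

lemma sqrt_Q_le_Vq_norm: "sqrt (Q u) \<le> Vq_norm M F E q u"
  unfolding Vq_norm_def by simp

lemma Vq_norm_le: "u \<in> Fe \<Longrightarrow> Vq_norm M F E q u \<le> Lq_norm M q u + sqrt (Q u)"
  unfolding Vq_norm_def using sqrt_add_le_add_sqrt[of "(Lq_norm M q u)\<^sup>2" "Q u"] Q_nonneg[of u]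
  by (simp add: Lq_norm_nonneg)

lemma Vq_norm_alt: "u \<in> Fe \<Longrightarrow> Vq_norm M F E q u = sqrt ((Lq_norm M q u)\<^sup>2 + (sqrt (Q u))\<^sup>2)"
  unfolding Vq_norm_def using Q_nonneg[of u] by simp

lemma Vq_norm_triangle:
  assumes q: "1 \<le> q" and u: "u \<in> Vq_space M F E q" and v: "v \<in> Vq_space M F E q"
  shows "Vq_norm M F E q (\<lambda>x. u x + v x) \<le> Vq_norm M F E q u + Vq_norm M F E q v"
proof -
  have uv: "u \<in> Lq_space M q" "v \<in> Lq_space M q" "u \<in> Fe" "v \<in> Fe"
    using u v by (auto simp: Vq_space_iff)
  let ?L = "Lq_norm M q" and ?R = "\<lambda>u. sqrt (Q u)"
  have "Vq_norm M F E q (\<lambda>x. u x + v x) = sqrt ((?L (\<lambda>x. u x + v x))\<^sup>2 + (?R (\<lambda>x. u x + v x))\<^sup>2)"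
    by (rule Vq_norm_alt[OF Fe_add[OF uv(3,4)]])
  also have "\<dots> \<le> sqrt ((?L u + ?L v)\<^sup>2 + (?R u + ?R v)\<^sup>2)"
    using Q_nonneg[OF Fe_add[OF uv(3,4)]]
    by (intro real_sqrt_le_mono add_mono power_mono Lq_norm_triangle[OF q] sqrt_Q_triangle Lq_norm_nonneg uv)
       simp
  also have "\<dots> \<le> sqrt ((?L u)\<^sup>2 + (?R u)\<^sup>2) + sqrt ((?L v)\<^sup>2 + (?R v)\<^sup>2)"
    by (rule real_sqrt_sum_squares_triangle_ineq)
  also have "\<dots> = Vq_norm M F E q u + Vq_norm M F E q v"
    using uv by (simp only: Vq_norm_alt)
  finally show ?thesis .
qed

text \<open>
  The limit in \<open>L\<^sup>q\<close> is also a limit almost everywhere along a subsequence. Completeness of the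
  extended Dirichlet space, applied to that subsequence, shows that it has finite energy and is
  the limit in energy.
\<close>

lemma Vq_complete:
  assumes sigma: "sigma_finite_measure M" and q: "1 \<le> q"
    and s: "\<And>n. s n \<in> Vq_space M F E q"
    and cau: "\<And>e. e > 0 \<Longrightarrow> \<exists>k. \<forall>m\<ge>k. \<forall>n\<ge>k. Vq_norm M F E q (\<lambda>x. s m x - s n x) < e"
  shows "\<exists>u\<in>Vq_space M F E q. (\<lambda>n. Vq_norm M F E q (\<lambda>x. s n x - u x)) \<longlonglongrightarrow> 0"
proof -
  have sL: "s n \<in> Lq_space M q" and sFe: "s n \<in> Fe" for n using s by (auto simp: Vq_space_iff)
  have dFe: "(\<lambda>x. s m x - s n x) \<in> Fe" for m n by (rule Fe_diff[OF sFe sFe])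
  have cauL: "\<exists>k. \<forall>m\<ge>k. \<forall>n\<ge>k. Lq_norm M q (\<lambda>x. s m x - s n x) < e" if e: "e > 0" for e
  proof -
    obtain k where "\<And>m n. m \<ge> k \<Longrightarrow> n \<ge> k \<Longrightarrow> Vq_norm M F E q (\<lambda>x. s m x - s n x) < e"
      using cau[OF e] by blast
    then have "Lq_norm M q (\<lambda>x. s m x - s n x) < e" if "m \<ge> k" "n \<ge> k" for m n
      using that by (intro le_less_trans[OF Lq_norm_le_Vq_norm[OF dFe]])
    then show ?thesis by blast
  qed
  have cauQ: "\<exists>k. \<forall>m\<ge>k. \<forall>n\<ge>k. sqrt (Q (\<lambda>x. s m x - s n x)) < e" if e: "e > 0" for e
  proof -
    obtain k where "\<And>m n. m \<ge> k \<Longrightarrow> n \<ge> k \<Longrightarrow> Vq_norm M F E q (\<lambda>x. s m x - s n x) < e"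
      using cau[OF e] by blast
    then have "sqrt (Q (\<lambda>x. s m x - s n x)) < e" if "m \<ge> k" "n \<ge> k" for m n
      using that by (intro le_less_trans[OF sqrt_Q_le_Vq_norm])
    then show ?thesis by blast
  qed
  obtain u r where u: "u \<in> Lq_space M q" "(\<lambda>n. Lq_norm M q (\<lambda>x. s n x - u x)) \<longlonglongrightarrow> 0"
    and r: "strict_mono (r :: nat \<Rightarrow> nat)" "AE x in M. (\<lambda>k. s (r k) x) \<longlonglongrightarrow> u x"
    by (rule Lq_complete[where s = s, OF q sL cauL]) (assumption | rule that)+
  have cauQr: "\<exists>k. \<forall>m\<ge>k. \<forall>n\<ge>k. sqrt (Q (\<lambda>x. s (r m) x - s (r n) x)) < e" if e: "e > 0" for e
  proof -
    obtain k where k: "\<And>m n. m \<ge> k \<Longrightarrow> n \<ge> k \<Longrightarrow> sqrt (Q (\<lambda>x. s m x - s n x)) < e"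
      using cauQ[OF e] by blast
    have "r n \<ge> k" if "n \<ge> k" for n using that seq_suble[OF r(1), of n] by simp
    then show ?thesis using k by blast
  qed
  note ext = extended_complete[where u = "\<lambda>k. s (r k)",
    OF sigma sFe r(2) Lq_space_measurable[OF u(1)] cauQr]
  have uFe: "u \<in> Fe" by (rule ext(1))
  have limr: "(\<lambda>k. sqrt (Q (\<lambda>x. s (r k) x - u x))) \<longlonglongrightarrow> 0" by (rule ext(2))
  have suFe: "(\<lambda>x. s n x - u x) \<in> Fe" for n by (rule Fe_diff[OF sFe uFe])
  have limQ: "(\<lambda>n. sqrt (Q (\<lambda>x. s n x - u x))) \<longlonglongrightarrow> 0"
  proof (rule cauchy_tendsto_zero_if_subseq[OF _ _ _ r(1) limr])
    show "0 \<le> sqrt (Q (\<lambda>x. s n x - u x))" for n using Q_nonneg[OF suFe] by simp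
    show "sqrt (Q (\<lambda>x. s n x - u x)) \<le> sqrt (Q (\<lambda>x. s n x - s k x)) + sqrt (Q (\<lambda>x. s k x - u x))" for n k
      by (rule sqrt_Q_diff_triangle[OF sFe sFe uFe])
  qed (fact cauQ)
  have "(\<lambda>n. Vq_norm M F E q (\<lambda>x. s n x - u x)) \<longlonglongrightarrow> 0"
  proof (rule tendsto_sandwich[OF _ _ tendsto_const])
    show "(\<lambda>n. Lq_norm M q (\<lambda>x. s n x - u x) + sqrt (Q (\<lambda>x. s n x - u x))) \<longlonglongrightarrow> 0"
      using tendsto_add[OF u(2) limQ] by simp
    show "\<forall>\<^sub>F n in sequentially. 0 \<le> Vq_norm M F E q (\<lambda>x. s n x - u x)"
      using order_trans[OF Lq_norm_nonneg Lq_norm_le_Vq_norm[OF suFe]] by simp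
  qed (use Vq_norm_le[OF suFe] in simp)
  then show ?thesis using u(1) uFe by (auto simp: Vq_space_iff)
qed

lemma Vq_banach:
  assumes sigma: "sigma_finite_measure M" and q: "1 \<le> q"
  shows "ae_banach M (Vq_space M F E q) (Vq_norm M F E q)"
proof -
  have q0: "0 < q" using q by simp
  interpret ae_function_space M "Vq_space M F E q" "Vq_norm M F E q"
  proof
    fix u v c assume u: "u \<in> Vq_space M F E q"
    then have u': "u \<in> Lq_space M q" "u \<in> Fe" "u \<in> borel_measurable M"
      by (auto simp: Vq_space_iff Lq_space_measurable)
    show "u \<in> borel_measurable M" by (rule u')
    show "(\<lambda>x. c * u x) \<in> Vq_space M F E q"
      using Lq_space_scale[OF u'(1)] Fe_scale[OF u'(2)] by (simp add: Vq_space_iff)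
    show "v \<in> Vq_space M F E q" if "v \<in> borel_measurable M" "AE x in M. u x = v x"
      using Lq_space_ae[OF u'(1) that] Fe_ae[OF u'(2) that] by (simp add: Vq_space_iff)
    assume v: "v \<in> Vq_space M F E q"
    then have v': "v \<in> Lq_space M q" "v \<in> Fe" "v \<in> borel_measurable M"
      by (auto simp: Vq_space_iff Lq_space_measurable)
    show "(\<lambda>x. u x + v x) \<in> Vq_space M F E q"
      using Lq_space_add[OF q u'(1) v'(1)] Fe_add[OF u'(2) v'(2)] by (simp add: Vq_space_iff)
    show "Vq_norm M F E q u = Vq_norm M F E q v" if "AE x in M. u x = v x"
      using Lq_norm_ae[OF u'(3) v'(3) that] Q_ae[OF that] by (simp add: Vq_norm_def)
  next
    show "(\<lambda>x. 0) \<in> Vq_space M F E q"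
      using Lq_space_zero[OF q0] dom_Fe[OF dom_zero] by (simp add: Vq_space_iff)
  qed
  show ?thesis
  proof (rule ae_banachI)
    fix u c assume u: "u \<in> Vq_space M F E q"
    then have u': "u \<in> Lq_space M q" "u \<in> Fe" by (auto simp: Vq_space_iff)
    show nonneg: "0 \<le> Vq_norm M F E q u"
      by (rule order_trans[OF Lq_norm_nonneg Lq_norm_le_Vq_norm[OF u'(2)]])
    show "AE x in M. u x = 0" if "Vq_norm M F E q u = 0"
      using Lq_norm_le_Vq_norm[OF u'(2), of q] Lq_norm_nonneg[of M q u] that
      by (intro Lq_norm_eq_zero[OF q0 u'(1)]) simp
    have "(Lq_norm M q (\<lambda>x. c * u x))\<^sup>2 + Q (\<lambda>x. c * u x) = c\<^sup>2 * ((Lq_norm M q u)\<^sup>2 + Q u)"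
      by (simp add: Lq_norm_scale[OF q0] Q_scale[OF u'(2)] power_mult_distrib distrib_left)
    then show "Vq_norm M F E q (\<lambda>x. c * u x) = \<bar>c\<bar> * Vq_norm M F E q u"
      by (simp add: Vq_norm_def real_sqrt_mult)
  next
    show "Vq_norm M F E q (\<lambda>x. 0) = 0"
      using Lq_norm_scale[OF q0, of M 0 "\<lambda>x. 0"] Q_zero by (simp add: Vq_norm_def)
  qed (fact Vq_norm_triangle[OF q] Vq_complete[OF sigma q])+
qed

end

theorem proposition3p2:
  fixes M :: "'a::metric_space measure"
    and F :: "('a \<Rightarrow> real) set"
    and E :: "('a \<Rightarrow> real) \<Rightarrow> ('a \<Rightarrow> real) \<Rightarrow> real"
    and q :: real
  assumes "metric_measure_space M"
    and "dirichlet_form M F E"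
    and "1 < q"
  shows "ae_banach M (Vq_space M F E q) (Vq_norm M F E q)"
  using dirichlet_form.Vq_banach[OF assms(2) metric_measure_space_sigma_finite[OF assms(1)]] assms(3)
  by simp

end
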